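(* Let $\Psi=(\psi_k)_{k\in K}$ be an $\mathcal A$-localized frame for $\mathcal H$ with $\inf_{k}\|\psi_k\|_{\mathcal H}>0$. Let $1\le p_1,p_2\le\infty$ and let $w_1,w_2$ be $\mathcal A$-admissible weights. Then $$\mathcal H^{p_1}_{w_1}\subseteq\mathcal H^{p_2}_{w_2}\iff \ell^{p_1}_{w_1}\subseteq\ell^{p_2}_{w_2}.$$
   Context: $\mathcal H$ is a separable Hilbert space and $K\subseteq\mathbb R^d$ a countable separated index set; sequences and matrices are indexed by $K$. $\ell^{00}$ denotes the finitely supported sequences. A weight is a sequence $w=(w_k)$ with $w_k>0$; $\ell^p_w=\{c:(w_kc_k)\in\ell^p\}$ with $\|c\|_{\ell^p_w}=\|(w_kc_k)\|_{\ell^p}$. A frame $\Psi=(\psi_k)_{k\in K}$ satisfies $A\|f\|^2\le\sum_k|\langle f,\psi_k\rangle|^2\le B\|f\|^2$ for all $f\in\mathcal H$ with some $A,B>0$; $C_\Psi f=(\langle f,\psi_k\rangle)_k$, $D_\Psi c=\sum_kc_k\psi_k$, $S_\Psi=D_\Psi C_\Psi$; the canonical dual frame is $\tilde\Psi=(\tilde\psi_k)$, $\tilde\psi_k=S_\Psi^{-1}\psi_k$. Cross-Gram matrix: $(G_{\Psi,\Phi})_{k,l}=\langle\phi_l,\psi_k\rangle$. $\mathcal A$ is a fixed solid spectral matrix algebra: a Banach $*$-algebra of matrices over $K$ such that (i) $\mathcal A\subseteq\mathcal B(\ell^2)$; (ii) $\mathcal A$ is inverse-closed: $A\in\mathcal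 A$ invertible on $\ell^2$ implies $A^{-1}\in\mathcal A$; (iii) $\mathcal A$ is solid: $A\in\mathcal A$ and $|b_{k,l}|\le|a_{k,l}|$ for all $k,l$ imply $B=(b_{k,l})\in\mathcal A$ and $\|B\|_{\mathcal A}\le\|A\|_{\mathcal A}$. A frame $\Psi$ is $\mathcal A$-localized if $G_{\Psi,\Psi}\in\mathcal A$; then also $G_{\tilde\Psi,\Psi},G_{\tilde\Psi,\tilde\Psi}\in\mathcal A$ (known). A weight $w$ is $\mathcal A$-admissible if every $A\in\mathcal A$ defines a bounded operator on $\ell^p_w$ for all $1\le p\le\infty$. Coorbit spaces: $\mathcal H^{00}=\{\sum_kc_k\psi_k:c\in\ell^{00}\}$. For $1\le p<\infty$, $\mathcal H^p_w$ is the completion of $\mathcal H^{00}$ in the norm $\|f\|_{\mathcal H^p_w}=\|C_{\tilde\Psi}f\|_{\ell^p_w}$. $\mathcal H^\infty_w$ is the set of equivalence classes $f=[f_n]$ of sequences $f_n\in\mathcal H$ such that $\alpha_k=\lim_n\langle f_n,\tilde\psi_k\rangle$ exists for all $k$ and $\sup_n\|C_{\tilde\Psi}f_n\|_{\ell^\infty_w}<\infty$, where $(f_n)\sim(g_n)$ iff $\langle f_n-g_n,\tilde\psi_k\rangle\to0$ for all $k$; $C_{\tilde\Psi}f=\alpha$ and $\|f\|_{\mathcal H^\infty_w}=\|\alpha\|_{\ell^\infty_w}$. Elements of the coorbit spaces are identified with their coefficient sequences $C_{\tilde\Psi}f$; an inclusion between coorbit spaces (also for different weights) is understood through this identificatio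n. *)

theory Defs
  imports "HOL-Analysis.Analysis"
begin

section \<open>Complex Hilbert spaces\<close>

text \<open>
  Complex inner product spaces: a norm given by an inner product that is linear in the first and
  conjugate-linear in the second argument. Hilbert spaces are the types of sort
  \<open>{complex_ip, complete_space}\<close>.
\<close>

class complex_ip = real_normed_vector +
  fixes scaleC :: "complex \<Rightarrow> 'a \<Rightarrow> 'a" (infixr \<open>*\<^sub>C\<close> 75)
    and cinner :: "'a \<Rightarrow> 'a \<Rightarrow> complex"
  assumes scaleC_add_right: "a *\<^sub>C (x + y) = a *\<^sub>C x + a *\<^sub>C y"
    and scaleC_add_left: "(a + b) *\<^sub>C x = a *\<^sub>C x + b *\<^sub>C x"
    and scaleC_scaleC: "a *\<^sub>C b *\<^sub>C x = (a * b) *\<^sub>C x"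
    and scaleC_of_real: "complex_of_real r *\<^sub>C x = r *\<^sub>R x"
    and cinner_commute: "cinner x y = cnj (cinner y x)"
    and cinner_add_left: "cinner (x + y) z = cinner x z + cinner y z"
    and cinner_scaleC_left: "cinner (a *\<^sub>C x) y = a * cinner x y"
    and cinner_self: "cinner x x = complex_of_real ((norm x)\<^sup>2)"

section \<open>Sequences and matrices over an index set\<close>

text \<open>
  Sequences and matrices over \<open>K\<close> are total functions vanishing outside \<open>K\<close> and \<open>K \<times> K\<close>, so that
  equality of functions is equality of sequences and matrices. Since \<open>K\<close> carries no order, all
  series over \<open>K\<close> converge unconditionally.
\<close>

type_synonym 'k cseq = "'k \<Rightarrow> complex"
type_synonym 'k cmat = "'k \<Rightarrow> 'k \<Rightarrow> complex"

definition seqs :: "'k set \<Rightarrow> 'k cseq set" where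
  "seqs K = {c. \<forall>k. k \<notin> K \<longrightarrow> c k = 0}"

definition fin_seqs :: "'k set \<Rightarrow> 'k cseq set" where
  "fin_seqs K = {c \<in> seqs K. finite {k. c k \<noteq> 0}}"

definition mats :: "'k set \<Rightarrow> 'k cmat set" where
  "mats K = {A. \<forall>k l. k \<notin> K \<or> l \<notin> K \<longrightarrow> A k l = 0}"

definition mat_app :: "'k set \<Rightarrow> 'k cmat \<Rightarrow> 'k cseq \<Rightarrow> 'k cseq" where
  "mat_app K A c = (\<lambda>k. \<Sum>\<^sub>\<infinity>l\<in>K. A k l * c l)"

definition mat_mult :: "'k set \<Rightarrow> 'k cmat \<Rightarrow> 'k cmat \<Rightarrow> 'k cmat" where
  "mat_mult K A B = (\<lambda>k l. \<Sum>\<^sub>\<infinity>j\<in>K. A k j * B j l)"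

definition mat_adj :: "'k cmat \<Rightarrow> 'k cmat" where
  "mat_adj A = (\<lambda>k l. cnj (A l k))"

text \<open>The weighted norm is extended-valued: it is \<open>\<infinity>\<close> exactly on the sequences outside \<open>\<ell>\<^sup>p\<^sub>w\<close>.\<close>

definition lp_norm :: "'k set \<Rightarrow> ennreal \<Rightarrow> ('k \<Rightarrow> real) \<Rightarrow> 'k cseq \<Rightarrow> ennreal" where
  "lp_norm K p w c =
    (if p = \<infinity> then (SUP k\<in>K. ennreal (w k * cmod (c k)))
     else if (\<lambda>k. (w k * cmod (c k)) powr enn2real p) summable_on K
       then ennreal ((\<Sum>\<^sub>\<infinity>k\<in>K. (w k * cmod (c k)) powr enn2real p) powr (1 / enn2real p))
     else \<infinity>)"

definition lp :: "'k set \<Rightarrow> ennreal \<Rightarrow> ('k \<Rightarrow> real) \<Rightarrow> 'k cseq set" where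
  "lp K p w = {c \<in> seqs K. lp_norm K p w c < \<infinity>}"

abbreviation l2 :: "'k set \<Rightarrow> 'k cseq set" where
  "l2 K \<equiv> lp K 2 (\<lambda>_. 1)"

definition bounded_on_lp :: "'k set \<Rightarrow> ennreal \<Rightarrow> ('k \<Rightarrow> real) \<Rightarrow> 'k cmat \<Rightarrow> bool" where
  "bounded_on_lp K p w A \<longleftrightarrow>
    (\<forall>c\<in>lp K p w. (\<forall>k\<in>K. (\<lambda>l. A k l * c l) summable_on K) \<and> mat_app K A c \<in> lp K p w) \<and>
    (\<exists>M::real. \<forall>c\<in>lp K p w. lp_norm K p w (mat_app K A c) \<le> ennreal M * lp_norm K p w c)"

section \<open>Solid spectral matrix algebras\<close>

text \<open>
  In \<open>inverse_closed\<close> the inverse operator on \<open>\<ell>\<^sup>2\<close> is turned into a matrix by applying it to the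
  standard unit vectors. No unit is required in the algebra.
\<close>

locale solid_spectral_algebra =
  fixes K :: "'k set" and \<A> :: "'k cmat set" and N :: "'k cmat \<Rightarrow> real"
  assumes carrier: "\<A> \<subseteq> mats K"
    and zero_closed: "(\<lambda>_ _. 0) \<in> \<A>"
    and add_closed: "A \<in> \<A> \<Longrightarrow> B \<in> \<A> \<Longrightarrow> (\<lambda>k l. A k l + B k l) \<in> \<A>"
    and scale_closed: "A \<in> \<A> \<Longrightarrow> (\<lambda>k l. z * A k l) \<in> \<A>"
    and mult_closed: "A \<in> \<A> \<Longrightarrow> B \<in> \<A> \<Longrightarrow> mat_mult K A B \<in> \<A>"
    and adj_closed: "A \<in> \<A> \<Longrightarrow> mat_adj A \<in> \<A>"
    and norm_nonneg: "A \<in> \<A> \<Longrightarrow> 0 \<le> N A"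
    and norm_zero_iff: "A \<in> \<A> \<Longrightarrow> N A = 0 \<longleftrightarrow> A = (\<lambda>_ _. 0)"
    and norm_triangle: "A \<in> \<A> \<Longrightarrow> B \<in> \<A> \<Longrightarrow> N (\<lambda>k l. A k l + B k l) \<le> N A + N B"
    and norm_scale: "A \<in> \<A> \<Longrightarrow> N (\<lambda>k l. z * A k l) = cmod z * N A"
    and norm_mult: "A \<in> \<A> \<Longrightarrow> B \<in> \<A> \<Longrightarrow> N (mat_mult K A B) \<le> N A * N B"
    and norm_adj: "A \<in> \<A> \<Longrightarrow> N (mat_adj A) = N A"
    and complete: "(\<And>n::nat. F n \<in> \<A>) \<Longrightarrow>
      (\<And>e::real. 0 < e \<Longrightarrow> \<exists>M. \<forall>m\<ge>M. \<forall>n\<ge>M. N (\<lambda>k l. F m k l - F n k l) < e) \<Longrightarrow>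
      \<exists>A\<in>\<A>. (\<lambda>n. N (\<lambda>k l. F n k l - A k l)) \<longlonglongrightarrow> 0"
    and bounded_l2: "A \<in> \<A> \<Longrightarrow> bounded_on_lp K 2 (\<lambda>_. 1) A"
    and inverse_closed: "A \<in> \<A> \<Longrightarrow> bij_betw (mat_app K A) (l2 K) (l2 K) \<Longrightarrow>
      (\<lambda>k l. if l \<in> K then the_inv_into (l2 K) (mat_app K A) (\<lambda>j. of_bool (j = l)) k else 0) \<in> \<A>"
    and solid: "A \<in> \<A> \<Longrightarrow> B \<in> mats K \<Longrightarrow> (\<And>k l. cmod (B k l) \<le> cmod (A k l)) \<Longrightarrow>
      B \<in> \<A> \<and> N B \<le> N A"

definition admissible :: "'k set \<Rightarrow> 'k cmat set \<Rightarrow> ('k \<Rightarrow> real) \<Rightarrow> bool" where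
  "admissible K \<A> w \<longleftrightarrow>
    (\<forall>k\<in>K. 0 < w k) \<and> (\<forall>A\<in>\<A>. \<forall>p. 1 \<le> p \<longrightarrow> bounded_on_lp K p w A)"

section \<open>Frames\<close>

text \<open>Only the values of a family \<open>\<psi>\<close> on \<open>K\<close> are relevant.\<close>

definition is_frame :: "'k set \<Rightarrow> ('k \<Rightarrow> 'h::{complex_ip, complete_space}) \<Rightarrow> bool" where
  "is_frame K \<psi> \<longleftrightarrow> (\<exists>A>0. \<exists>B>0. \<forall>f.
    (\<lambda>k. (cmod (cinner f (\<psi> k)))\<^sup>2) summable_on K \<and>
    A * (norm f)\<^sup>2 \<le> (\<Sum>\<^sub>\<infinity>k\<in>K. (cmod (cinner f (\<psi> k)))\<^sup>2) \<and>
    (\<Sum>\<^sub>\<infinity>k\<in>K. (cmod (cinner f (\<psi> k)))\<^sup>2) \<le> B * (norm f)\<^sup>2)"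

definition analysis_op :: "'k set \<Rightarrow> ('k \<Rightarrow> 'h::{complex_ip, complete_space}) \<Rightarrow> 'h \<Rightarrow> 'k cseq" where
  "analysis_op K \<psi> f = (\<lambda>k. if k \<in> K then cinner f (\<psi> k) else 0)"

definition synthesis_op :: "'k set \<Rightarrow> ('k \<Rightarrow> 'h::{complex_ip, complete_space}) \<Rightarrow> 'k cseq \<Rightarrow> 'h" where
  "synthesis_op K \<psi> c = (\<Sum>\<^sub>\<infinity>k\<in>K. c k *\<^sub>C \<psi> k)"

definition frame_op :: "'k set \<Rightarrow> ('k \<Rightarrow> 'h::{complex_ip, complete_space}) \<Rightarrow> 'h \<Rightarrow> 'h" where
  "frame_op K \<psi> f = synthesis_op K \<psi> (analysis_op K \<psi> f)"

definition dual_frame :: "'k set \<Rightarrow> ('k \<Rightarrow> 'h::{complex_ip, complete_space}) \<Rightarrow> 'k \<Rightarrow> 'h" where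
  "dual_frame K \<psi> k = inv (frame_op K \<psi>) (\<psi> k)"

definition cross_gram ::
  "'k set \<Rightarrow> ('k \<Rightarrow> 'h::{complex_ip, complete_space}) \<Rightarrow> ('k \<Rightarrow> 'h) \<Rightarrow> 'k cmat" where
  "cross_gram K \<psi> \<phi> = (\<lambda>k l. if k \<in> K \<and> l \<in> K then cinner (\<phi> l) (\<psi> k) else 0)"

definition localized_frame ::
  "'k set \<Rightarrow> 'k cmat set \<Rightarrow> ('k \<Rightarrow> 'h::{complex_ip, complete_space}) \<Rightarrow> bool" where
  "localized_frame K \<A> \<psi> \<longleftrightarrow> is_frame K \<psi> \<and> cross_gram K \<psi> \<psi> \<in> \<A>"

section \<open>Coorbit spaces\<close>

definition H00 :: "'k set \<Rightarrow> ('k \<Rightarrow> 'h::{complex_ip, complete_space}) \<Rightarrow> 'h set" where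
  "H00 K \<psi> = synthesis_op K \<psi> ` fin_seqs K"

definition coorbit_norm ::
  "'k set \<Rightarrow> ('k \<Rightarrow> 'h::{complex_ip, complete_space}) \<Rightarrow> ennreal \<Rightarrow> ('k \<Rightarrow> real) \<Rightarrow> 'h \<Rightarrow> ennreal" where
  "coorbit_norm K \<psi> p w f = lp_norm K p w (analysis_op K (dual_frame K \<psi>) f)"

text \<open>
  Elements of the coorbit spaces are equivalence classes of sequences: for \<open>p < \<infinity>\<close> the classes of
  Cauchy sequences in \<^term>\<open>H00 K \<psi>\<close> that make up its completion, for \<open>p = \<infinity>\<close> the classes of
  sequences with convergent coefficients that are bounded in \<open>\<ell>\<^sup>\<infinity>\<^sub>w\<close>.
\<close>

definition coorbit_seqs ::
  "'k set \<Rightarrow> ('k \<Rightarrow> 'h::{complex_ip, complete_space}) \<Rightarrow> ennreal \<Rightarrow> ('k \<Rightarrow> real) \<Rightarrow> (nat \<Rightarrow> 'h) set" where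
  "coorbit_seqs K \<psi> p w =
    (if p = \<infinity> then
       {f. (\<forall>k\<in>K. convergent (\<lambda>n. cinner (f n) (dual_frame K \<psi> k))) \<and>
           (SUP n. lp_norm K \<infinity> w (analysis_op K (dual_frame K \<psi>) (f n))) < \<infinity>}
     else
       {f. (\<forall>n. f n \<in> H00 K \<psi>) \<and>
           (\<forall>e>0. \<exists>M. \<forall>m\<ge>M. \<forall>n\<ge>M. coorbit_norm K \<psi> p w (f m - f n) < e)})"

definition coorbit_rel ::
  "'k set \<Rightarrow> ('k \<Rightarrow> 'h::{complex_ip, complete_space}) \<Rightarrow> ennreal \<Rightarrow> ('k \<Rightarrow> real)
    \<Rightarrow> ((nat \<Rightarrow> 'h) \<times> (nat \<Rightarrow> 'h)) set" where
  "coorbit_rel K \<psi> p w =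
    {(f, g). f \<in> coorbit_seqs K \<psi> p w \<and> g \<in> coorbit_seqs K \<psi> p w \<and>
       (if p = \<infinity> then \<forall>k\<in>K. (\<lambda>n. cinner (f n - g n) (dual_frame K \<psi> k)) \<longlonglongrightarrow> 0
        else (\<lambda>n. coorbit_norm K \<psi> p w (f n - g n)) \<longlonglongrightarrow> 0)}"

definition coorbit ::
  "'k set \<Rightarrow> ('k \<Rightarrow> 'h::{complex_ip, complete_space}) \<Rightarrow> ennreal \<Rightarrow> ('k \<Rightarrow> real)
    \<Rightarrow> (nat \<Rightarrow> 'h) set set" where
  "coorbit K \<psi> p w = coorbit_seqs K \<psi> p w // coorbit_rel K \<psi> p w"

text \<open>
  The coefficient operator of the dual frame on equivalence classes. For \<open>p < \<infinity>\<close>, it is the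
  continuous extension from \<^term>\<open>H00 K \<psi>\<close>: the coefficient sequences of a Cauchy sequence converge
  in \<open>\<ell>\<^sup>p\<^sub>w\<close>, hence (the weight being positive) coordinatewise to the same limit.
\<close>

definition coorbit_coeffs ::
  "'k set \<Rightarrow> ('k \<Rightarrow> 'h::{complex_ip, complete_space}) \<Rightarrow> (nat \<Rightarrow> 'h) set \<Rightarrow> 'k cseq" where
  "coorbit_coeffs K \<psi> X = (THE \<alpha>. \<forall>f\<in>X. \<forall>k.
     (\<lambda>n. analysis_op K (dual_frame K \<psi>) (f n) k) \<longlonglongrightarrow> \<alpha> k)"

definition coorbit_subset ::
  "'k set \<Rightarrow> ('k \<Rightarrow> 'h::{complex_ip, complete_space}) \<Rightarrow> ennreal \<Rightarrow> ('k \<Rightarrow> real)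
    \<Rightarrow> ennreal \<Rightarrow> ('k \<Rightarrow> real) \<Rightarrow> bool" where
  "coorbit_subset K \<psi> p1 w1 p2 w2 \<longleftrightarrow>
     coorbit_coeffs K \<psi> ` coorbit K \<psi> p1 w1 \<subseteq> coorbit_coeffs K \<psi> ` coorbit K \<psi> p2 w2"

end

theory Submission
  imports Defs
begin

text \<open>
  Let \<open>P\<close> with entries \<open>\<langle>\<psi>\<^sub>l, S\<^sup>-\<^sup>1 \<psi>\<^sub>k\<rangle>\<close> be the cross-Gram matrix of the dual frame and the frame. It lies in
  the algebra, by a Riesz projection argument: the resolvent of the Gram matrix is continuous in the
  norm of the algebra on a circle separating \<open>0\<close> from the rest of the spectrum. Hence \<open>P\<close> acts
  boundedly on all the weighted spaces, and the coefficient sequences of the coorbit space are exactly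
  the image of \<open>\<ell>\<^sup>p\<^sub>w\<close> under \<open>P\<close>. So an inclusion of sequence spaces gives one of coorbit spaces.
  Conversely, if \<open>P\<close> maps the first sequence space into the second, then \<open>P(\<epsilon>d)\<close> lies in the second
  for every \<open>d\<close> in the first and every sign pattern \<open>\<epsilon>\<close>; by Baire category and averaging over \<open>\<epsilon>\<close>
  this passes to the diagonal part \<open>(P\<^sub>k\<^sub>k d\<^sub>k)\<close>, and \<open>P\<^sub>k\<^sub>k = \<langle>\<psi>\<^sub>k, S\<^sup>-\<^sup>1 \<psi>\<^sub>k\<rangle>\<close> is bounded below
  because \<open>\<parallel>\<psi>\<^sub>k\<parallel>\<close> is.
\<close>

section \<open>Weighted sequence spaces\<close>

text \<open>The frame may be redundant, and this shapes both halves of the argument. The Gram matrix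
  G is then not injective on l2, so inverse-closedness cannot be applied to G itself. It applies to
  1 - z G with 1/z in the gap between 0 and the lower frame bound a, and the inverse of S is
  recovered from these resolvents by averaging over the circle of radius a/2. Inverse-closedness
  comes without a bound on the norm of the inverse, so compactness of the circle has to supply one;
  the contour integral is taken as a limit of dyadic means, for which completeness along sequences
  is enough. Likewise P need not be onto, so an inclusion of coorbit spaces speaks about sequences
  of the form P d only. It is moreover purely qualitative: each P(\<epsilon>d) lies in the second
  space, with no bound common to all \<epsilon>. Baire category yields a common bound once finitely
  many signs are frozen.\<close>

text \<open>A uniform treatment of finite and infinite \<open>p\<close>: a sequence lies in \<open>\<ell>\<^sup>p\<^sub>w\<close> iff the sums of its
  weighted \<open>lp_exp p\<close>-th powers over the sets in \<open>lp_fam K p\<close> are bounded.\<close>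

definition lp_fam :: "'k set \<Rightarrow> ennreal \<Rightarrow> 'k set set" where
  "lp_fam K p = (if p = \<infinity> then (\<lambda>k. {k}) ` K else {H. finite H \<and> H \<subseteq> K})"

definition lp_exp :: "ennreal \<Rightarrow> real" where
  "lp_exp p = (if p = \<infinity> then 1 else enn2real p)"

lemma lp_exp_ge_1: "1 \<le> p \<Longrightarrow> 1 \<le> lp_exp p"
  by (cases p) (auto simp: lp_exp_def simp flip: ennreal_1)

lemma lp_fam_finite: "H \<in> lp_fam K p \<Longrightarrow> finite H \<and> H \<subseteq> K"
  by (auto simp: lp_fam_def split: if_splits)

lemma singleton_lp_fam: "k \<in> K \<Longrightarrow> {k} \<in> lp_fam K p"
  by (auto simp: lp_fam_def)

text \<open>For nonnegative terms, bounded finite partial sums give summability together with the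
  same bound. This finitary criterion replaces the case split in \<open>lp_norm\<close> from here
  on.\<close>

lemma lp_norm_le_iff:
  assumes p: "1 \<le> p" and w: "\<forall>k\<in>K. 0 < w k" and r: "0 \<le> r"
  shows "lp_norm K p w c \<le> ennreal r \<longleftrightarrow>
    (\<forall>H\<in>lp_fam K p. (\<Sum>k\<in>H. (w k * cmod (c k)) powr lp_exp p) \<le> r powr lp_exp p)"
proof (cases "p = \<infinity>")
  case True
  have "0 \<le> w k * cmod (c k)" if "k \<in> K" for k
    using w that by (simp add: less_imp_le)
  with True r show ?thesis
    by (auto simp: lp_norm_def lp_fam_def lp_exp_def SUP_le_iff)
next
  case False
  define q where "q = lp_exp p"
  have q: "q \<ge> 1" "enn2real p = q"
    using lp_exp_ge_1[OF p] False by (auto simp: q_def lp_exp_def)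
  define f where "f = (\<lambda>k. (w k * cmod (c k)) powr q)"
  have f: "f k \<ge> 0" for k by (simp add: f_def)
  have pow: "s powr (1 / q) \<le> r \<longleftrightarrow> s \<le> r powr q" if "0 \<le> s" for s
  proof
    assume "s powr (1 / q) \<le> r"
    hence "(s powr (1 / q)) powr q \<le> r powr q" using q by (intro powr_mono2) auto
    thus "s \<le> r powr q" using q that by (simp add: powr_powr)
  next
    assume "s \<le> r powr q"
    hence "s powr (1 / q) \<le> (r powr q) powr (1 / q)" using q that by (intro powr_mono2) auto
    thus "s powr (1 / q) \<le> r" using q r by (simp add: powr_powr)
  qed
  have "lp_norm K p w c \<le> ennreal r \<longleftrightarrow> f summable_on K \<and> infsum f K \<le> r powr q"
    using False r f pow[of "infsum f K"] q
    by (auto simp: lp_norm_def f_def infsum_nonneg top_unique)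
  also have "\<dots> \<longleftrightarrow> (\<forall>H. finite H \<and> H \<subseteq> K \<longrightarrow> sum f H \<le> r powr q)"
  proof (intro iffI allI impI conjI)
    fix H assume "f summable_on K \<and> infsum f K \<le> r powr q" "finite H \<and> H \<subseteq> K"
    thus "sum f H \<le> r powr q"
      using finite_sum_le_infsum[of f K H] f by force
  next
    assume *: "\<forall>H. finite H \<and> H \<subseteq> K \<longrightarrow> sum f H \<le> r powr q"
    show "f summable_on K"
      using * f by (intro nonneg_bdd_above_summable_on bdd_aboveI[where M = "r powr q"]) auto
    thus "infsum f K \<le> r powr q"
      using * by (intro infsum_le_finite_sums) auto
  qed
  finally show ?thesis
    using False by (auto simp: lp_fam_def f_def q_def)
qed

lemma lp_norm_finiteD:
  assumes "lp_norm K p w c < \<infinity>"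
  obtains r where "0 \<le> r" "lp_norm K p w c = ennreal r"
  using assms by (cases "lp_norm K p w c") auto

lemma mem_lp_iff:
  assumes p: "1 \<le> p" and w: "\<forall>k\<in>K. 0 < w k"
  shows "c \<in> lp K p w \<longleftrightarrow> c \<in> seqs K \<and>
    (\<exists>B. \<forall>H\<in>lp_fam K p. (\<Sum>k\<in>H. (w k * cmod (c k)) powr lp_exp p) \<le> B)"
proof -
  have "(\<exists>B. \<forall>H\<in>lp_fam K p. (\<Sum>k\<in>H. (w k * cmod (c k)) powr lp_exp p) \<le> B)
    \<longleftrightarrow> lp_norm K p w c < \<infinity>"
  proof
    assume "\<exists>B. \<forall>H\<in>lp_fam K p. (\<Sum>k\<in>H. (w k * cmod (c k)) powr lp_exp p) \<le> B"
    then obtain B where B: "\<And>H. H \<in> lp_fam K p \<Longrightarrow> (\<Sum>k\<in>H. (w k * cmod (c k)) powr lp_exp p) \<le> B"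
      by blast
    \<comment> \<open>B may be negative when \<open>lp_fam K p\<close> is empty, which happens for
      empty K and p = \<infinity>.\<close>
    define r where "r = max B 0 powr (1 / lp_exp p)"
    have r: "0 \<le> r" "r powr lp_exp p = max B 0"
      using lp_exp_ge_1[OF p] by (auto simp: r_def powr_powr)
    have "lp_norm K p w c \<le> ennreal r"
      unfolding lp_norm_le_iff[OF p w r(1)] r(2) using B by (auto intro: le_max_iff_disj[THEN iffD2])
    thus "lp_norm K p w c < \<infinity>"
      by (simp add: le_less_trans)
  next
    assume "lp_norm K p w c < \<infinity>"
    then obtain r where "0 \<le> r" "lp_norm K p w c = ennreal r"
      by (rule lp_norm_finiteD)
    thus "\<exists>B. \<forall>H\<in>lp_fam K p. (\<Sum>k\<in>H. (w k * cmod (c k)) powr lp_exp p) \<le> B"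
      using lp_norm_le_iff[OF p w, of r c] by auto
  qed
  thus ?thesis by (auto simp: lp_def)
qed

lemma lp_norm_mono:
  assumes p: "1 \<le> p" and w: "\<forall>k\<in>K. 0 < w k" and cd: "\<And>k. k \<in> K \<Longrightarrow> cmod (c k) \<le> cmod (d k)"
  shows "lp_norm K p w c \<le> lp_norm K p w d"
proof (cases "lp_norm K p w d < \<infinity>")
  case True
  then obtain r where r: "0 \<le> r" "lp_norm K p w d = ennreal r"
    by (rule lp_norm_finiteD)
  have "(\<Sum>k\<in>H. (w k * cmod (c k)) powr lp_exp p) \<le> r powr lp_exp p" if H: "H \<in> lp_fam K p" for H
  proof -
    have "(\<Sum>k\<in>H. (w k * cmod (c k)) powr lp_exp p) \<le> (\<Sum>k\<in>H. (w k * cmod (d k)) powr lp_exp p)"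
      using lp_fam_finite[OF H] lp_exp_ge_1[OF p] w cd
      by (intro sum_mono powr_mono2 mult_left_mono mult_nonneg_nonneg)
         (auto intro: less_imp_le dest!: subsetD)
    also have "\<dots> \<le> r powr lp_exp p"
      using lp_norm_le_iff[OF p w r(1), of d] r(2) H by auto
    finally show ?thesis .
  qed
  thus ?thesis unfolding r(2) lp_norm_le_iff[OF p w r(1)] by blast
qed (simp add: less_top[symmetric])

lemma lp_solid:
  assumes "1 \<le> p" "\<forall>k\<in>K. 0 < w k" "\<And>k. k \<in> K \<Longrightarrow> cmod (c k) \<le> cmod (d k)"
    and "d \<in> lp K p w" "c \<in> seqs K"
  shows "c \<in> lp K p w"
  using lp_norm_mono[OF assms(1,2), of c d] assms(3-5) by (auto simp: lp_def)

lemma coord_le_lp_norm: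
  assumes p: "1 \<le> p" and w: "\<forall>k\<in>K. 0 < w k" and k: "k \<in> K"
  shows "ennreal (w k * cmod (c k)) \<le> lp_norm K p w c"
proof (cases "lp_norm K p w c < \<infinity>")
  case True
  then obtain r where r: "0 \<le> r" "lp_norm K p w c = ennreal r"
    by (rule lp_norm_finiteD)
  have "(w k * cmod (c k)) powr lp_exp p \<le> r powr lp_exp p"
    using lp_norm_le_iff[OF p w r(1), of c] r(2) singleton_lp_fam[OF k, of p] by auto
  hence "w k * cmod (c k) \<le> r"
    using lp_exp_ge_1[OF p] r(1) by (meson linorder_not_less less_le_trans powr_less_mono2 zero_less_one)
  thus ?thesis by (simp add: r ennreal_leI)
qed (simp add: less_top[symmetric])

text \<open>A crude substitute for Minkowski: it serves closure of the spaces under addition, where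
  the constant does not matter.\<close>

lemma powr_add_le:
  fixes x y :: real
  assumes "0 \<le> x" "0 \<le> y" "0 \<le> q"
  shows "(x + y) powr q \<le> 2 powr q * (x powr q + y powr q)"
proof -
  have "(x + y) powr q \<le> (2 * max x y) powr q"
    using assms by (intro powr_mono2) auto
  also have "\<dots> = 2 powr q * max x y powr q"
    using assms by (simp add: powr_mult)
  also have "max x y powr q \<le> x powr q + y powr q"
    by (simp add: max_def)
  finally show ?thesis by simp
qed

lemma lp_add:
  assumes p: "1 \<le> p" and w: "\<forall>k\<in>K. 0 < w k" and c: "c \<in> lp K p w" and d: "d \<in> lp K p w"
  shows "(\<lambda>k. c k + d k) \<in> lp K p w"
proof -
  define q where "q = lp_exp p"
  have q: "0 \<le> q" using lp_exp_ge_1[OF p] by (simp add: q_def)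
  obtain B where B: "\<And>H. H \<in> lp_fam K p \<Longrightarrow> (\<Sum>k\<in>H. (w k * cmod (c k)) powr q) \<le> B"
    using c mem_lp_iff[OF p w] by (auto simp: q_def)
  obtain D where D: "\<And>H. H \<in> lp_fam K p \<Longrightarrow> (\<Sum>k\<in>H. (w k * cmod (d k)) powr q) \<le> D"
    using d mem_lp_iff[OF p w] by (auto simp: q_def)
  have "(\<Sum>k\<in>H. (w k * cmod (c k + d k)) powr q) \<le> 2 powr q * (B + D)" if H: "H \<in> lp_fam K p" for H
  proof -
    have "(w k * cmod (c k + d k)) powr q
      \<le> 2 powr q * ((w k * cmod (c k)) powr q + (w k * cmod (d k)) powr q)" if "k \<in> H" for k
    proof -
      have wk: "0 \<le> w k" using that lp_fam_finite[OF H] w by (auto intro: less_imp_le)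
      have "(w k * cmod (c k + d k)) powr q \<le> (w k * cmod (c k) + w k * cmod (d k)) powr q"
        unfolding distrib_left[symmetric] using wk q norm_triangle_ineq
        by (intro powr_mono2 mult_left_mono) auto
      also have "\<dots> \<le> 2 powr q * ((w k * cmod (c k)) powr q + (w k * cmod (d k)) powr q)"
        using wk q by (intro powr_add_le) auto
      finally show ?thesis .
    qed
    hence "(\<Sum>k\<in>H. (w k * cmod (c k + d k)) powr q)
      \<le> (\<Sum>k\<in>H. 2 powr q * ((w k * cmod (c k)) powr q + (w k * cmod (d k)) powr q))"
      by (rule sum_mono)
    also have "\<dots> = 2 powr q *
      ((\<Sum>k\<in>H. (w k * cmod (c k)) powr q) + (\<Sum>k\<in>H. (w k * cmod (d k)) powr q))"
      by (simp only: sum_distrib_left[symmetric] sum.distrib)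
    also have "\<dots> \<le> 2 powr q * (B + D)"
      using B[OF H] D[OF H] by (intro mult_left_mono add_mono) auto
    finally show ?thesis .
  qed
  moreover have "(\<lambda>k. c k + d k) \<in> seqs K"
    using c d by (auto simp: lp_def seqs_def)
  ultimately show ?thesis
    unfolding mem_lp_iff[OF p w] q_def by blast
qed

lemma lp_scale:
  assumes p: "1 \<le> p" and w: "\<forall>k\<in>K. 0 < w k" and c: "c \<in> lp K p w"
  shows "(\<lambda>k. z * c k) \<in> lp K p w"
proof -
  define q where "q = lp_exp p"
  obtain B where B: "\<And>H. H \<in> lp_fam K p \<Longrightarrow> (\<Sum>k\<in>H. (w k * cmod (c k)) powr q) \<le> B"
    using c mem_lp_iff[OF p w] by (auto simp: q_def)
  have "(\<Sum>k\<in>H. (w k * cmod (z * c k)) powr q) \<le> cmod z powr q * B" if H: "H \<in> lp_fam K p" for H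
  proof -
    have "(w k * cmod (z * c k)) powr q = cmod z powr q * (w k * cmod (c k)) powr q" if "k \<in> H" for k
    proof -
      have "0 \<le> w k" using that lp_fam_finite[OF H] w by (auto intro: less_imp_le)
      hence "(w k * cmod (z * c k)) powr q = (cmod z * (w k * cmod (c k))) powr q"
        by (simp add: norm_mult mult_ac)
      also have "\<dots> = cmod z powr q * (w k * cmod (c k)) powr q"
        by (rule powr_mult)
      finally show ?thesis .
    qed
    hence "(\<Sum>k\<in>H. (w k * cmod (z * c k)) powr q) = cmod z powr q * (\<Sum>k\<in>H. (w k * cmod (c k)) powr q)"
      by (simp add: sum_distrib_left)
    thus ?thesis using B[OF H] by (simp add: mult_left_mono)
  qed
  moreover have "(\<lambda>k. z * c k) \<in> seqs K"
    using c by (auto simp: lp_def seqs_def)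
  ultimately show ?thesis
    unfolding mem_lp_iff[OF p w] q_def by blast
qed

lemma lp_diff:
  assumes p: "1 \<le> p" and w: "\<forall>k\<in>K. 0 < w k" and c: "c \<in> lp K p w" and d: "d \<in> lp K p w"
  shows "(\<lambda>k. c k - d k) \<in> lp K p w"
  using lp_add[OF p w c lp_scale[OF p w d, of "-1"]] by simp

text \<open>Fatou property: each constraint of the finitary criterion involves finitely many
  coordinates, so it survives coordinatewise limits.\<close>

lemma lp_norm_limit_le:
  assumes p: "1 \<le> p" and w: "\<forall>k\<in>K. 0 < w k" and r: "0 \<le> r"
    and lim: "\<And>k. k \<in> K \<Longrightarrow> (\<lambda>n::nat. a n k) \<longlonglongrightarrow> c k"
    and le: "\<forall>\<^sub>F n in sequentially. lp_norm K p w (a n) \<le> ennreal r"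
  shows "lp_norm K p w c \<le> ennreal r"
  unfolding lp_norm_le_iff[OF p w r]
proof
  fix H assume H: "H \<in> lp_fam K p"
  have "(\<lambda>n. \<Sum>k\<in>H. (w k * cmod (a n k)) powr lp_exp p)
      \<longlonglongrightarrow> (\<Sum>k\<in>H. (w k * cmod (c k)) powr lp_exp p)"
    using lim lp_fam_finite[OF H] lp_exp_ge_1[OF p] w
    by (intro tendsto_sum tendsto_powr2 tendsto_mult tendsto_const tendsto_norm)
       (auto intro!: always_eventually mult_nonneg_nonneg dest!: subsetD intro: less_imp_le)
  moreover have "\<forall>\<^sub>F n in sequentially. (\<Sum>k\<in>H. (w k * cmod (a n k)) powr lp_exp p) \<le> r powr lp_exp p"
    using le by eventually_elim (use lp_norm_le_iff[OF p w r] H in auto)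
  ultimately show "(\<Sum>k\<in>H. (w k * cmod (c k)) powr lp_exp p) \<le> r powr lp_exp p"
    by (rule tendsto_upperbound) simp
qed

lemma fin_seqs_subset_lp:
  assumes p: "1 \<le> p" and w: "\<forall>k\<in>K. 0 < w k"
  shows "fin_seqs K \<subseteq> lp K p w"
proof
  fix c assume c: "c \<in> fin_seqs K"
  define F where "F = {k. c k \<noteq> 0}"
  have F: "finite F" using c by (simp add: F_def fin_seqs_def)
  have "(\<Sum>k\<in>H. (w k * cmod (c k)) powr lp_exp p) \<le> (\<Sum>k\<in>F. (w k * cmod (c k)) powr lp_exp p)"
    if H: "H \<in> lp_fam K p" for H
  proof -
    have "(\<Sum>k\<in>H. (w k * cmod (c k)) powr lp_exp p) = (\<Sum>k\<in>H \<inter> F. (w k * cmod (c k)) powr lp_exp p)"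
      using lp_fam_finite[OF H] by (intro sum.mono_neutral_right) (auto simp: F_def)
    also have "\<dots> \<le> (\<Sum>k\<in>F. (w k * cmod (c k)) powr lp_exp p)"
      using F by (intro sum_mono2) auto
    finally show ?thesis .
  qed
  thus "c \<in> lp K p w"
    using c unfolding mem_lp_iff[OF p w] by (auto simp: fin_seqs_def)
qed

section \<open>Finite truncations along an enumeration of the index set\<close>

definition trunc :: "'k set \<Rightarrow> 'k cseq \<Rightarrow> 'k cseq" where
  "trunc F c = (\<lambda>k. if k \<in> F then c k else 0)"

text \<open>Coorbit elements are classes of sequences, so the net of finite subsets of K is replaced
  by an increasing sequence of them, taken from an enumeration of K.\<close>

definition exhaust :: "'k set \<Rightarrow> nat \<Rightarrow> 'k set" where
  "exhaust K n = {k \<in> K. to_nat_on K k < n}"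

lemma exhaust_subset: "exhaust K n \<subseteq> K"
  by (auto simp: exhaust_def)

lemma exhaust_finite: "countable K \<Longrightarrow> finite (exhaust K n)"
  by (rule inj_on_finite[where f = "to_nat_on K" and B = "{..<n}"])
     (auto simp: exhaust_def intro: inj_on_subset[OF inj_on_to_nat_on])

lemma finite_subset_exhaust:
  assumes "finite F" "F \<subseteq> K"
  shows "\<exists>M. \<forall>n\<ge>M. F \<subseteq> exhaust K n"
proof (intro exI allI impI)
  fix n assume n: "n \<ge> Suc (Max (to_nat_on K ` F))"
  show "F \<subseteq> exhaust K n"
  proof
    fix k assume k: "k \<in> F"
    have "to_nat_on K k \<le> Max (to_nat_on K ` F)" using assms k by auto
    hence "to_nat_on K k < n" using n by linarith
    thus "k \<in> exhaust K n" using k assms by (auto simp: exhaust_def)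
  qed
qed

lemma filterlim_exhaust:
  assumes "countable K"
  shows "filterlim (exhaust K) (finite_subsets_at_top K) sequentially"
  unfolding filterlim_finite_subsets_at_top
proof (intro allI impI)
  fix F assume F: "finite F \<and> F \<subseteq> K"
  then obtain M where "\<forall>n\<ge>M. F \<subseteq> exhaust K n" using finite_subset_exhaust by blast
  thus "\<forall>\<^sub>F n in sequentially. finite (exhaust K n) \<and> F \<subseteq> exhaust K n \<and> exhaust K n \<subseteq> K"
    using exhaust_finite[OF assms]
    by (intro eventually_sequentiallyI[of M]) (auto simp: exhaust_def)
qed

lemma trunc_exhaust_fin_seqs: "countable K \<Longrightarrow> trunc (exhaust K n) c \<in> fin_seqs K"
  using exhaust_subset[of K n]
  by (auto simp: fin_seqs_def seqs_def trunc_def intro: finite_subset[OF _ exhaust_finite])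

text \<open>Late truncations agree on a finite set F that carries all but \<open>e powr q\<close> of
  the sum; their difference is dominated by c off F, hence by the tail.\<close>

lemma lp_norm_trunc_Cauchy:
  assumes p: "1 \<le> p" "p \<noteq> \<infinity>" and w: "\<forall>k\<in>K. 0 < w k"
    and c: "c \<in> lp K p w" and e: "0 < e"
  shows "\<exists>M. \<forall>m\<ge>M. \<forall>n\<ge>M.
    lp_norm K p w (\<lambda>k. trunc (exhaust K m) c k - trunc (exhaust K n) c k) \<le> ennreal e"
proof -
  define q where "q = lp_exp p"
  have q: "q \<ge> 1" "enn2real p = q"
    using lp_exp_ge_1[OF p(1)] p(2) by (auto simp: q_def lp_exp_def)
  define f where "f = (\<lambda>k. (w k * cmod (c k)) powr q)"
  have f: "f k \<ge> 0" for k by (simp add: f_def)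
  have sf: "f summable_on K"
    using c p(2) by (auto simp: lp_def lp_norm_def f_def q split: if_splits)
  have "0 < e powr q" using e by simp
  with infsum_finite_approximation[OF sf]
  obtain F where F: "finite F" "F \<subseteq> K" "dist (sum f F) (infsum f K) \<le> e powr q"
    by blast
  obtain M where M: "\<And>n. n \<ge> M \<Longrightarrow> F \<subseteq> exhaust K n"
    using finite_subset_exhaust[OF F(1,2)] by blast
  show ?thesis
  proof (intro exI allI impI)
    fix m n assume mn: "M \<le> m" "M \<le> n"
    define d where "d = (\<lambda>k. trunc (exhaust K m) c k - trunc (exhaust K n) c k)"
    have d0: "d k = 0" if "k \<in> F" for k
      using that M[OF mn(1)] M[OF mn(2)] by (auto simp: d_def trunc_def)
    have dle: "cmod (d k) \<le> cmod (c k)" for k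
      by (auto simp: d_def trunc_def)
    have "(\<Sum>k\<in>H. (w k * cmod (d k)) powr q) \<le> e powr q" if H: "H \<in> lp_fam K p" for H
    proof -
      have "(\<Sum>k\<in>H. (w k * cmod (d k)) powr q) = (\<Sum>k\<in>H - F. (w k * cmod (d k)) powr q)"
        using lp_fam_finite[OF H] d0 by (intro sum.mono_neutral_right) auto
      also have "\<dots> \<le> sum f (H - F)"
        unfolding f_def using lp_fam_finite[OF H] w q dle
        by (intro sum_mono powr_mono2 mult_left_mono mult_nonneg_nonneg)
           (auto intro: less_imp_le dest!: subsetD)
      also have "\<dots> = sum f (H \<union> F) - sum f F"
        using lp_fam_finite[OF H] F(1) by (subst sum_diff[symmetric]) (auto intro: arg_cong[where f = "sum f"])
      also have "sum f (H \<union> F) \<le> infsum f K"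
        using lp_fam_finite[OF H] F f by (intro finite_sum_le_infsum sf) auto
      also have "infsum f K - sum f F \<le> e powr q"
        using F(3) by (simp add: dist_real_def)
      finally show ?thesis by simp
    qed
    thus "lp_norm K p w (\<lambda>k. trunc (exhaust K m) c k - trunc (exhaust K n) c k) \<le> ennreal e"
      unfolding lp_norm_le_iff[OF p(1) w less_imp_le[OF e]] d_def[symmetric] q_def by blast
  qed
qed

section \<open>Unconditional images and the diagonal of a matrix\<close>

text \<open>Uniform boundedness by Baire: closed level sets cover the space of sign patterns, one of
  them has an interior point, and a basic open set around that point constrains finitely many
  coordinates only. The index type may be uncountable, so the Baire property is drawn from
  compactness instead of a complete metric.\<close>

lemma bounded_on_cylinder:
  fixes \<Phi> :: "('k \<Rightarrow> bool) \<Rightarrow> 'i \<Rightarrow> real"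
  assumes cont: "\<And>i. i \<in> I \<Longrightarrow> continuous_on UNIV (\<lambda>\<epsilon>. \<Phi> \<epsilon> i)"
    and bdd: "\<And>\<epsilon>. \<exists>B. \<forall>i\<in>I. \<Phi> \<epsilon> i \<le> B"
  shows "\<exists>F \<epsilon>0 B. finite F \<and> (\<forall>\<epsilon>. (\<forall>k\<in>F. \<epsilon> k = \<epsilon>0 k) \<longrightarrow> (\<forall>i\<in>I. \<Phi> \<epsilon> i \<le> B))"
proof -
  let ?X = "product_topology (\<lambda>_. euclidean :: bool topology) (UNIV :: 'k set)"
  define C where "C = (\<lambda>n::nat. {\<epsilon>. \<forall>i\<in>I. \<Phi> \<epsilon> i \<le> real n})"
  have "compact_space (euclidean :: bool topology)"
    by (simp add: compact_space_def compactin_euclidean_iff finite_imp_compact)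
  hence compact: "compact_space ?X"
    by (simp add: compact_space_product_topology)
  have "Hausdorff_space (euclidean :: bool topology)"
    unfolding Hausdorff_space_def disjnt_def open_openin[symmetric]
    by (intro allI impI hausdorff) simp
  hence "Hausdorff_space ?X"
    by (simp add: Hausdorff_space_product_topology)
  with compact have loc: "locally_compact_space ?X \<and> regular_space ?X"
    by (simp add: compact_imp_locally_compact_space compact_Hausdorff_imp_regular_space)
  have closed: "closedin ?X (C n)" for n
  proof -
    have "C n = (\<Inter>i\<in>I. {\<epsilon>. \<Phi> \<epsilon> i \<le> real n})" by (auto simp: C_def)
    moreover have "closed \<dots>"
      using cont by (intro closed_INT ballI closed_Collect_le continuous_on_const) auto
    ultimately show ?thesis by (simp add: euclidean_product_topology)
  qed
  have UNIV: "(\<Union>n. C n) = UNIV"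
  proof (intro set_eqI iffI UNIV_I)
    fix \<epsilon>
    obtain B where B: "\<forall>i\<in>I. \<Phi> \<epsilon> i \<le> B" using bdd by blast
    obtain n where "B \<le> real n" using real_arch_simple by blast
    with B have "\<epsilon> \<in> C n" by (auto simp: C_def intro: order_trans)
    thus "\<epsilon> \<in> (\<Union>n. C n)" by blast
  qed
  have "\<exists>n. ?X interior_of C n \<noteq> {}"
  proof (rule ccontr)
    assume "\<not> ?thesis"
    hence emp: "?X interior_of C n = {}" for n by simp
    have "?X interior_of \<Union>(range C) = {}"
    proof (rule Baire_category_alt[OF disjI2[OF loc]])
      show "countable (range C)" by simp
      show "closedin ?X T \<and> ?X interior_of T = {}" if "T \<in> range C" for T
        using that closed emp by auto
    qed
    moreover have "?X interior_of UNIV = UNIV"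
      using interior_of_topspace[of ?X] by simp
    ultimately show False using UNIV by simp
  qed
  then obtain n \<epsilon>0 where "\<epsilon>0 \<in> ?X interior_of C n" by blast
  moreover have "openin ?X (?X interior_of C n)" by simp
  ultimately have "\<exists>U. \<epsilon>0 \<in> (\<Pi>\<^sub>E i\<in>UNIV. U i) \<and> (\<forall>i. openin (euclidean :: bool topology) (U i)) \<and>
      finite {i. U i \<noteq> topspace (euclidean :: bool topology)} \<and>
      (\<Pi>\<^sub>E i\<in>UNIV. U i) \<subseteq> ?X interior_of C n"
    by (intro product_topology_open_contains_basis)
  then obtain U where U: "\<epsilon>0 \<in> (\<Pi>\<^sub>E i\<in>UNIV. U i)" "finite {i. U i \<noteq> UNIV}"
      "(\<Pi>\<^sub>E i\<in>UNIV. U i) \<subseteq> ?X interior_of C n"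
    by auto
  have "\<epsilon> \<in> C n" if "\<forall>k\<in>{i. U i \<noteq> UNIV}. \<epsilon> k = \<epsilon>0 k" for \<epsilon>
  proof -
    have "\<epsilon> k \<in> U k" for k
      using that U(1) by (cases "U k = UNIV") (auto simp: PiE_def Pi_def)
    hence "\<epsilon> \<in> (\<Pi>\<^sub>E i\<in>UNIV. U i)" by auto
    thus ?thesis using U(3) interior_of_subset[of ?X "C n"] by blast
  qed
  with U(2) show ?thesis
    by (intro exI[of _ "{i. U i \<noteq> UNIV}"] exI[of _ \<epsilon>0] exI[of _ "real n"]) (auto simp: C_def)
qed

text \<open>Signs are coded by booleans so that sign patterns are the points of the compact product
  space \<open>'k \<Rightarrow> bool\<close>.\<close>

definition bsgn :: "bool \<Rightarrow> complex" where
  "bsgn b = (if b then 1 else -1)"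

lemma norm_bsgn [simp]: "cmod (bsgn b) = 1"
  by (simp add: bsgn_def)

lemma bsgn_sq [simp]: "bsgn b * bsgn b = 1"
  by (simp add: bsgn_def)

text \<open>Orthogonality of Rademacher functions: toggling k in S flips the first factor and leaves
  the second alone, so the sum equals its own negative. The value b stands for a sign that is frozen
  outside G.\<close>

lemma sum_bsgn_orthogonal:
  assumes k: "k \<in> G" and l: "l \<noteq> k" and G: "finite G"
  shows "(\<Sum>S\<in>Pow G. bsgn (k \<notin> S) * bsgn (if l \<in> G then l \<notin> S else b)) = 0"
proof -
  define h where "h = (\<lambda>S. bsgn (k \<notin> S) * bsgn (if l \<in> G then l \<notin> S else b))"
  define i where "i = (\<lambda>S. if k \<in> S then S - {k} else insert k S)"
  have "sum h (Pow G) = (\<Sum>S\<in>Pow G. - h S)"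
    by (rule sum.reindex_bij_witness[of _ i i]) (use k l in \<open>auto simp: i_def h_def bsgn_def\<close>)
  hence "sum h (Pow G) = - sum h (Pow G)" by (simp add: sum_negf)
  hence "sum h (Pow G) = 0" by simp
  thus ?thesis unfolding h_def .
qed

text \<open>Convexity on the open half-line is extended to the endpoint 0, since weighted moduli may
  vanish; with one argument 0 the inequality reduces to \<open>s powr q \<le> s\<close> on the unit
  interval.\<close>

lemma convex_on_powr_nonneg:
  assumes q: "1 \<le> q"
  shows "convex_on {0..} (\<lambda>x::real. x powr q)"
proof (rule convex_onI)
  fix t x y :: real assume t: "0 < t" "t < 1" and xy: "x \<in> {0..}" "y \<in> {0..}"
  have small: "s powr q \<le> s" if "0 < s" "s < 1" for s :: real
    using powr_mono'[of 1 q s] q that by simp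
  consider "x = 0" | "y = 0" | "x > 0" "y > 0" using xy by fastforce
  thus "((1 - t) *\<^sub>R x + t *\<^sub>R y) powr q \<le> (1 - t) * x powr q + t * y powr q"
  proof cases
    case 1
    thus ?thesis using small[of t] t by (simp add: powr_mult mult_right_mono)
  next
    case 2
    thus ?thesis using small[of "1 - t"] t by (simp add: powr_mult mult_right_mono)
  next
    case 3
    thus ?thesis using convex_onD[OF powr_convex[OF q], of t x y] t by simp
  qed
qed simp

lemma has_sum_sum:
  fixes f :: "'i \<Rightarrow> 'k \<Rightarrow> 'b::topological_comm_monoid_add"
  assumes "\<And>i. i \<in> I \<Longrightarrow> (f i has_sum s i) A"
  shows "((\<lambda>x. \<Sum>i\<in>I. f i x) has_sum (\<Sum>i\<in>I. s i)) A"
  using assms by (induction I rule: infinite_finite_induct) (auto intro: has_sum_add)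

text \<open>Averaging over the signs kills the off-diagonal entries; the Baire category theorem on the
  compact group of all sign patterns supplies a bound that is uniform on a cylinder.\<close>

theorem diagonal_in_lp:
  fixes Q :: "'k \<Rightarrow> 'k \<Rightarrow> complex"
  assumes p: "1 \<le> p" and w: "\<forall>k\<in>K. 0 < w k"
    and rows: "\<And>k. k \<in> K \<Longrightarrow> Q k summable_on K"
    and signs: "\<And>\<epsilon>. (\<lambda>k. \<Sum>\<^sub>\<infinity>l\<in>K. bsgn (\<epsilon> l) * Q k l) \<in> lp K p w"
  shows "(\<lambda>k. if k \<in> K then Q k k else 0) \<in> lp K p w"
proof -
  define q where "q = lp_exp p"
  have q: "1 \<le> q" using lp_exp_ge_1[OF p] by (simp add: q_def)
  define h where "h = (\<lambda>\<epsilon> k. \<Sum>\<^sub>\<infinity>l\<in>K. bsgn (\<epsilon> l) * Q k l)"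
  \<comment> \<open>For complex series unconditional and absolute summability coincide, so sign
    changes are harmless and the M-test below applies uniformly in \<epsilon>.\<close>
  have abs: "(\<lambda>l. cmod (Q k l)) summable_on K" if "k \<in> K" for k
    using rows[OF that] summable_on_iff_abs_summable_on_complex by blast
  have sum: "(\<lambda>l. bsgn (\<epsilon> l) * Q k l) summable_on K" if "k \<in> K" for k and \<epsilon> :: "'k \<Rightarrow> bool"
    by (rule abs_summable_summable) (use abs[OF that] in \<open>simp add: norm_mult\<close>)
  have cont: "continuous_on UNIV (\<lambda>\<epsilon>. h \<epsilon> k)" if k: "k \<in> K" for k
    unfolding h_def
  proof (rule uniform_limit_theorem)
    show "uniform_limit UNIV (\<lambda>X \<epsilon>. \<Sum>l\<in>X. bsgn (\<epsilon> l) * Q k l)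
        (\<lambda>\<epsilon>. \<Sum>\<^sub>\<infinity>l\<in>K. bsgn (\<epsilon> l) * Q k l) (finite_subsets_at_top K)"
      by (rule Weierstrass_m_test_general[OF _ abs[OF k]]) (simp add: norm_mult)
    have "continuous_on UNIV (\<lambda>\<epsilon>::'k \<Rightarrow> bool. bsgn (\<epsilon> l))" for l
      by (rule continuous_on_compose2[OF Topological_Spaces.continuous_on_discrete[of UNIV bsgn]
            continuous_on_product_coordinates]) simp
    thus "\<forall>\<^sub>F X in finite_subsets_at_top K.
        continuous_on UNIV (\<lambda>\<epsilon>. \<Sum>l\<in>X. bsgn (\<epsilon> l) * Q k l)"
      by (intro always_eventually allI continuous_intros)
  qed simp
  have "\<exists>F \<epsilon>0 B. finite F \<and> (\<forall>\<epsilon>. (\<forall>k\<in>F. \<epsilon> k = \<epsilon>0 k) \<longrightarrow>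
      (\<forall>H\<in>lp_fam K p. (\<Sum>k\<in>H. (w k * cmod (h \<epsilon> k)) powr q) \<le> B))"
  proof (rule bounded_on_cylinder)
    fix H assume H: "H \<in> lp_fam K p"
    show "continuous_on UNIV (\<lambda>\<epsilon>. \<Sum>k\<in>H. (w k * cmod (h \<epsilon> k)) powr q)"
      using lp_fam_finite[OF H] q w
      by (intro continuous_on_sum continuous_on_powr' continuous_on_mult continuous_on_const
          continuous_on_norm cont ballI conjI impI mult_nonneg_nonneg)
        (auto simp: subset_iff less_imp_le)
  next
    fix \<epsilon>
    show "\<exists>B. \<forall>H\<in>lp_fam K p. (\<Sum>k\<in>H. (w k * cmod (h \<epsilon> k)) powr q) \<le> B"
      using signs[of \<epsilon>] unfolding mem_lp_iff[OF p w] h_def q_def by blast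
  qed
  then obtain F \<epsilon>0 B where FB: "finite F \<and> (\<forall>\<epsilon>. (\<forall>k\<in>F. \<epsilon> k = \<epsilon>0 k) \<longrightarrow>
      (\<forall>H\<in>lp_fam K p. (\<Sum>k\<in>H. (w k * cmod (h \<epsilon> k)) powr q) \<le> B))"
    by (elim exE)
  hence F: "finite F" ..
  have B: "(\<Sum>k\<in>H. (w k * cmod (h \<epsilon> k)) powr q) \<le> B"
    if "\<forall>k\<in>F. \<epsilon> k = \<epsilon>0 k" "H \<in> lp_fam K p" for \<epsilon> H
    using FB that by simp
  \<comment> \<open>The signs at indices in F are frozen by the cylinder and cannot be averaged;
    these finitely many diagonal terms are simply added to the bound.\<close>
  define D where "D = (\<Sum>k\<in>F. (w k * cmod (Q k k)) powr q)"
  have main: "(\<Sum>k\<in>H. (w k * cmod (Q k k)) powr q) \<le> D + B" if H: "H \<in> lp_fam K p" for H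
  proof -
    define G where "G = H - F"
    have G: "finite G" "G \<subseteq> K" using lp_fam_finite[OF H] by (auto simp: G_def)
    \<comment> \<open>Patterns equal to -1 exactly on S within G, and to \<epsilon>0 elsewhere. As G
      avoids F they all lie in the cylinder, so B bounds every one of them.\<close>
    define e where "e = (\<lambda>S l. if l \<in> G then l \<notin> S else \<epsilon>0 l)"
    define a :: real where "a = 1 / 2 ^ card G"
    have a: "a > 0" "(\<Sum>S\<in>Pow G. a) = 1"
      using G(1) by (auto simp: a_def card_Pow)
    \<comment> \<open>Multiplying the k-th coordinate by the sign at k and averaging over all S
      cancels every column except l = k.\<close>
    have diag: "Q k k = of_real a * (\<Sum>S\<in>Pow G. bsgn (k \<notin> S) * h (e S) k)" if k: "k \<in> G" for k
    proof -
      have "k \<in> K" using k G by auto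
      have "((\<lambda>l. \<Sum>S\<in>Pow G. bsgn (k \<notin> S) * (bsgn (e S l) * Q k l)) has_sum
          (\<Sum>S\<in>Pow G. bsgn (k \<notin> S) * h (e S) k)) K"
        unfolding h_def using sum[OF \<open>k \<in> K\<close>]
        by (intro has_sum_sum has_sum_cmult_right has_sum_infsum)
      also have "(\<lambda>l. \<Sum>S\<in>Pow G. bsgn (k \<notin> S) * (bsgn (e S l) * Q k l))
          = (\<lambda>l. if l = k then of_nat (2 ^ card G) * Q k k else 0)"
      proof
        fix l
        have "(\<Sum>S\<in>Pow G. bsgn (k \<notin> S) * (bsgn (e S l) * Q k l))
            = (\<Sum>S\<in>Pow G. bsgn (k \<notin> S) * bsgn (e S l)) * Q k l"
          by (simp add: sum_distrib_right mult.assoc)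
        also have "\<dots> = (if l = k then of_nat (2 ^ card G) * Q k k else 0)"
        proof (cases "l = k")
          case True
          thus ?thesis using k G(1) by (simp add: e_def card_Pow)
        next
          case False
          thus ?thesis
            using sum_bsgn_orthogonal[OF k False G(1), of "\<epsilon>0 l"] by (simp add: e_def)
        qed
        finally show "(\<Sum>S\<in>Pow G. bsgn (k \<notin> S) * (bsgn (e S l) * Q k l))
            = (if l = k then of_nat (2 ^ card G) * Q k k else 0)" .
      qed
      finally have "((\<lambda>l. if l = k then of_nat (2 ^ card G) * Q k k else 0) has_sum
          (\<Sum>S\<in>Pow G. bsgn (k \<notin> S) * h (e S) k)) K" .
      moreover have "((\<lambda>l. if l = k then of_nat (2 ^ card G) * Q k k else 0) has_sum
          (of_nat (2 ^ card G) * Q k k)) K"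
        using \<open>k \<in> K\<close> by (intro has_sum_finite_neutralI[where B = "{k}"]) auto
      ultimately have "(\<Sum>S\<in>Pow G. bsgn (k \<notin> S) * h (e S) k) = of_nat (2 ^ card G) * Q k k"
        by (rule has_sum_unique)
      thus ?thesis by (simp add: a_def)
    qed
    have jensen: "(w k * cmod (Q k k)) powr q \<le> (\<Sum>S\<in>Pow G. a * (w k * cmod (h (e S) k)) powr q)"
      if k: "k \<in> G" for k
    proof -
      have wk: "0 \<le> w k" using k G w by (auto intro: less_imp_le)
      have "cmod (Q k k) \<le> a * (\<Sum>S\<in>Pow G. cmod (h (e S) k))"
      proof -
        have "cmod (Q k k) = a * cmod (\<Sum>S\<in>Pow G. bsgn (k \<notin> S) * h (e S) k)"
          by (subst diag[OF k]) (use a(1) in \<open>simp add: norm_mult\<close>)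
        also have "\<dots> \<le> a * (\<Sum>S\<in>Pow G. cmod (bsgn (k \<notin> S) * h (e S) k))"
          using a(1) by (intro mult_left_mono norm_sum) auto
        finally show ?thesis by (simp add: norm_mult)
      qed
      hence "w k * cmod (Q k k) \<le> w k * (a * (\<Sum>S\<in>Pow G. cmod (h (e S) k)))"
        using wk by (rule mult_left_mono)
      also have "\<dots> = (\<Sum>S\<in>Pow G. a *\<^sub>R (w k * cmod (h (e S) k)))"
        by (simp add: sum_distrib_left mult_ac)
      finally have "(w k * cmod (Q k k)) powr q \<le> (\<Sum>S\<in>Pow G. a *\<^sub>R (w k * cmod (h (e S) k))) powr q"
        using wk q by (intro powr_mono2) auto
      also have "\<dots> \<le> (\<Sum>S\<in>Pow G. a * (w k * cmod (h (e S) k)) powr q)"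
        using G(1) a wk by (intro convex_on_sum[OF _ _ convex_on_powr_nonneg[OF q]]) auto
      finally show ?thesis .
    qed
    have "(\<Sum>k\<in>G. (w k * cmod (Q k k)) powr q)
        \<le> (\<Sum>k\<in>G. \<Sum>S\<in>Pow G. a * (w k * cmod (h (e S) k)) powr q)"
      using jensen by (rule sum_mono)
    \<comment> \<open>After the interchange the sum over k is taken for one fixed pattern, where B
      applies; the weights a add up to 1.\<close>
    also have "\<dots> = (\<Sum>S\<in>Pow G. a * (\<Sum>k\<in>G. (w k * cmod (h (e S) k)) powr q))"
      by (subst sum.swap) (simp add: sum_distrib_left)
    also have "\<dots> \<le> (\<Sum>S\<in>Pow G. a * B)"
    proof (rule sum_mono)
      fix S
      have "(\<Sum>k\<in>G. (w k * cmod (h (e S) k)) powr q) \<le> (\<Sum>k\<in>H. (w k * cmod (h (e S) k)) powr q)"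
        using lp_fam_finite[OF H] by (intro sum_mono2) (auto simp: G_def)
      also have "\<dots> \<le> B"
        using H by (intro B) (auto simp: e_def G_def)
      finally show "a * (\<Sum>k\<in>G. (w k * cmod (h (e S) k)) powr q) \<le> a * B"
        using a(1) by simp
    qed
    also have "\<dots> = B"
      using a(2) by (simp flip: sum_distrib_right)
    finally have 1: "(\<Sum>k\<in>G. (w k * cmod (Q k k)) powr q) \<le> B" .
    have "(\<Sum>k\<in>H. (w k * cmod (Q k k)) powr q)
        = (\<Sum>k\<in>H \<inter> F. (w k * cmod (Q k k)) powr q) + (\<Sum>k\<in>G. (w k * cmod (Q k k)) powr q)"
      unfolding G_def using lp_fam_finite[OF H] by (intro sum.Int_Diff) auto
    also have "(\<Sum>k\<in>H \<inter> F. (w k * cmod (Q k k)) powr q) \<le> D"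
      unfolding D_def using F by (intro sum_mono2) auto
    finally show ?thesis using 1 by simp
  qed
  have "(\<Sum>k\<in>H. (w k * cmod (if k \<in> K then Q k k else 0)) powr q) \<le> D + B" if H: "H \<in> lp_fam K p" for H
  proof -
    have "(\<Sum>k\<in>H. (w k * cmod (if k \<in> K then Q k k else 0)) powr q) = (\<Sum>k\<in>H. (w k * cmod (Q k k)) powr q)"
      using lp_fam_finite[OF H] by (intro sum.cong) auto
    thus ?thesis using main[OF H] by simp
  qed
  thus ?thesis
    unfolding mem_lp_iff[OF p w] q_def by (auto simp: seqs_def)
qed

section \<open>Frames and the frame operator\<close>

lemma cinner_add_right: "cinner x (y + z) = cinner x y + cinner (x :: 'a::complex_ip) z"
  by (metis cinner_add_left cinner_commute complex_cnj_add)

lemma cinner_scaleC_right: "cinner x (a *\<^sub>C y) = cnj a * cinner (x :: 'a::complex_ip) y"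
  by (metis cinner_scaleC_left cinner_commute complex_cnj_mult)

lemma scaleC_one [simp]: "1 *\<^sub>C x = (x :: 'a::complex_ip)"
  using scaleC_of_real[of 1 x] by simp

lemma scaleC_zero_left [simp]: "0 *\<^sub>C x = (0 :: 'a::complex_ip)"
  using scaleC_of_real[of 0 x] by simp

lemma scaleC_minus_one: "(- 1) *\<^sub>C x = - (x :: 'a::complex_ip)"
  using scaleC_of_real[of "-1" x] by simp

lemma scaleC_minus_left: "(- a) *\<^sub>C x = - (a *\<^sub>C (x :: 'a::complex_ip))"
  by (metis scaleC_minus_one scaleC_scaleC mult_minus1)

lemma scaleC_scaleR_commute: "a *\<^sub>C (r *\<^sub>R x) = r *\<^sub>R (a *\<^sub>C (x :: 'a::complex_ip))"
  by (metis scaleC_of_real scaleC_scaleC mult.commute)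

lemma scaleC_zero_right [simp]: "a *\<^sub>C 0 = (0 :: 'a::complex_ip)"
  using scaleC_scaleR_commute[of a 0 0] by simp

lemma scaleC_minus_right: "a *\<^sub>C (- x) = - (a *\<^sub>C (x :: 'a::complex_ip))"
  using scaleC_scaleR_commute[of a "-1" x] by simp

lemma scaleC_diff_right: "a *\<^sub>C (x - y) = a *\<^sub>C x - a *\<^sub>C (y :: 'a::complex_ip)"
  using scaleC_add_right[of a x "- y"] by (simp add: scaleC_minus_right)

lemma scaleC_diff_left: "(a - b) *\<^sub>C x = a *\<^sub>C x - b *\<^sub>C (x :: 'a::complex_ip)"
  using scaleC_add_left[of a "- b" x] by (simp add: scaleC_minus_left)

lemma cinner_minus_left: "cinner (- x) y = - cinner (x :: 'a::complex_ip) y"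
  using cinner_scaleC_left[of "-1" x y] by (simp add: scaleC_minus_one)

lemma cinner_minus_right: "cinner x (- y) = - cinner (x :: 'a::complex_ip) y"
  using cinner_scaleC_right[of x "-1" y] by (simp add: scaleC_minus_one)

lemma cinner_diff_left: "cinner (x - y) z = cinner x z - cinner (y :: 'a::complex_ip) z"
  using cinner_add_left[of x "- y" z] by (simp add: cinner_minus_left)

lemma cinner_diff_right: "cinner x (y - z) = cinner x y - cinner (x :: 'a::complex_ip) z"
  using cinner_add_right[of x y "- z"] by (simp add: cinner_minus_right)

lemma cinner_zero_left [simp]: "cinner 0 (y :: 'a::complex_ip) = 0"
  using cinner_scaleC_left[of 0 0 y] by simp

lemma cinner_zero_right [simp]: "cinner (y :: 'a::complex_ip) 0 = 0"
  using cinner_scaleC_right[of y 0 0] by simp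

lemma cinner_sum_left: "cinner (\<Sum>i\<in>I. f i) y = (\<Sum>i\<in>I. cinner (f i) (y :: 'a::complex_ip))"
  by (induction I rule: infinite_finite_induct) (auto simp: cinner_add_left)

lemma cinner_scaleR_left: "cinner (r *\<^sub>R x) y = of_real r * cinner x (y :: 'a::complex_ip)"
  by (metis cinner_scaleC_left scaleC_of_real)

lemma cinner_scaleR_right: "cinner x (r *\<^sub>R y) = of_real r * cinner x (y :: 'a::complex_ip)"
  by (metis cinner_scaleC_right scaleC_of_real complex_cnj_complex_of_real)

lemma cinner_cauchy_schwarz: "cmod (cinner x y) \<le> norm x * norm (y :: 'a::complex_ip)"
proof (cases "y = 0")
  case False
  define t where "t = (norm y)\<^sup>2"
  define s where "s = cinner x y"
  have t: "t > 0" using False by (simp add: t_def)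
  have yx: "cinner y x = cnj s" by (simp add: s_def cinner_commute[of y x])
  have yy: "cinner y y = of_real t" by (simp add: cinner_self t_def)
  define a where "a = s / of_real t"
  have "of_real ((norm (x - a *\<^sub>C y))\<^sup>2) = cinner (x - a *\<^sub>C y) (x - a *\<^sub>C y)"
    by (simp only: cinner_self)
  also have "\<dots> = of_real ((norm x)\<^sup>2) - cnj a * s - a * cnj s + a * cnj a * of_real t"
    by (simp add: cinner_diff_left cinner_diff_right cinner_scaleC_left cinner_scaleC_right yx yy
        cinner_self[of x] s_def[symmetric] algebra_simps)
  also have "\<dots> = of_real ((norm x)\<^sup>2 - (cmod s)\<^sup>2 / t)"
    using t by (simp add: a_def complex_norm_square field_simps del: of_real_power)
  finally have "(norm (x - a *\<^sub>C y))\<^sup>2 = (norm x)\<^sup>2 - (cmod s)\<^sup>2 / t"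
    using of_real_eq_iff by blast
  hence "(cmod s)\<^sup>2 / t \<le> (norm x)\<^sup>2"
    by (metis diff_ge_0_iff_ge zero_le_power2)
  hence "(cmod s)\<^sup>2 \<le> (norm x * norm y)\<^sup>2"
    using t by (simp add: t_def power_mult_distrib divide_le_eq)
  thus ?thesis by (simp add: s_def power2_le_iff_abs_le abs_mult)
qed simp

lemma norm_scaleC [simp]: "norm (a *\<^sub>C x) = cmod a * norm (x :: 'a::complex_ip)"
proof -
  have "of_real ((norm (a *\<^sub>C x))\<^sup>2) = (of_real ((cmod a * norm x)\<^sup>2) :: complex)"
    unfolding cinner_self[symmetric] cinner_scaleC_left cinner_scaleC_right
    by (simp add: cinner_self power_mult_distrib complex_norm_square del: of_real_power)
  hence "(norm (a *\<^sub>C x))\<^sup>2 = (cmod a * norm x)\<^sup>2" using of_real_eq_iff by blast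
  thus ?thesis by (simp add: power2_eq_iff_nonneg)
qed

lemma bounded_linear_cinner_left: "bounded_linear (\<lambda>x. cinner x (y :: 'a::complex_ip))"
  by (rule bounded_linear_intro[where K = "norm y"])
     (auto simp: cinner_add_left cinner_scaleR_left scaleR_conv_of_real cinner_cauchy_schwarz)

lemma bounded_linear_scaleC_right: "bounded_linear (\<lambda>x. a *\<^sub>C (x :: 'a::complex_ip))"
  by (rule bounded_linear_intro[where K = "cmod a"])
     (auto simp: scaleC_add_right scaleC_scaleR_commute mult.commute)

section \<open>Unconditional sums and bounded operators in Hilbert spaces\<close>

lemma summable_on_Cauchy_criterion:
  fixes f :: "'k \<Rightarrow> 'h::{real_normed_vector, complete_space}"
  assumes "\<And>e. 0 < e \<Longrightarrow> \<exists>F0. finite F0 \<and> F0 \<subseteq> A \<and>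
    (\<forall>F. finite F \<longrightarrow> F \<subseteq> A - F0 \<longrightarrow> norm (sum f F) < e)"
  shows "f summable_on A"
proof -
  have "\<exists>P. eventually P (finite_subsets_at_top A) \<and>
      (\<forall>F F'. P F \<and> P F' \<longrightarrow> dist (sum f F) (sum f F') < e)" if e: "0 < e" for e
  proof -
    obtain F0 where F0: "finite F0" "F0 \<subseteq> A"
      "\<And>F. finite F \<Longrightarrow> F \<subseteq> A - F0 \<Longrightarrow> norm (sum f F) < e / 2"
      using assms[of "e / 2"] e by auto
    define P where "P = (\<lambda>F. finite F \<and> F0 \<subseteq> F \<and> F \<subseteq> A)"
    have near: "norm (sum f F - sum f F0) < e / 2" if "P F" for F
    proof -
      have "sum f F - sum f F0 = sum f (F - F0)"
        using that by (auto simp: P_def sum_diff)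
      thus ?thesis using F0(3)[of "F - F0"] that by (auto simp: P_def)
    qed
    have "dist (sum f F) (sum f F') < e" if "P F" "P F'" for F F'
    proof -
      have "dist (sum f F) (sum f F') \<le> dist (sum f F) (sum f F0) + dist (sum f F') (sum f F0)"
        by (rule dist_triangle2)
      also have "\<dots> < e"
        using near[OF that(1)] near[OF that(2)] by (simp add: dist_norm)
      finally show ?thesis .
    qed
    moreover have "eventually P (finite_subsets_at_top A)"
      unfolding eventually_finite_subsets_at_top P_def using F0(1,2) by blast
    ultimately show ?thesis by blast
  qed
  hence "cauchy_filter (filtermap (sum f) (finite_subsets_at_top A))"
    by (simp add: cauchy_filter_metric_filtermap)
  moreover have "complete (UNIV :: 'h set)"
    by (rule complete_UNIV)
  ultimately obtain L where "(sum f \<longlongrightarrow> L) (finite_subsets_at_top A)"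
    using complete_uniform[where S = "UNIV :: 'h set"] by (force simp: filterlim_def)
  thus ?thesis
    using summable_on_def has_sum_def by blast
qed

lemma l2_iff: "c \<in> l2 K \<longleftrightarrow> c \<in> seqs K \<and> (\<lambda>k. (cmod (c k))\<^sup>2) summable_on K"
  by (auto simp: lp_def lp_norm_def)

text \<open>\<open>bounded_linear\<close> is linearity over the reals; complex homogeneity is added
  because scalars have to be pulled out of frame expansions.\<close>

definition bounded_clinear :: "('h::complex_ip \<Rightarrow> 'h) \<Rightarrow> bool" where
  "bounded_clinear X \<longleftrightarrow> bounded_linear X \<and> (\<forall>a x. X (a *\<^sub>C x) = a *\<^sub>C X x)"

lemma bounded_clinearI:
  fixes X :: "'h::complex_ip \<Rightarrow> 'h"
  assumes "\<And>x y. X (x + y) = X x + X y" "\<And>a x. X (a *\<^sub>C x) = a *\<^sub>C X x"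
    and "\<And>x. norm (X x) \<le> M * norm x"
  shows "bounded_clinear X"
  unfolding bounded_clinear_def
proof (intro conjI allI assms(2) bounded_linear_intro[where K = M] assms(1))
  show "X (r *\<^sub>R x) = r *\<^sub>R X x" for r x
    using assms(2)[of "of_real r" x] by (simp add: scaleC_of_real)
  show "norm (X x) \<le> norm x * M" for x
    using assms(3)[of x] by (simp add: mult.commute)
qed

section \<open>Frame bounds, synthesis and the frame operator\<close>

locale hilbert_frame =
  fixes K :: "'k set" and \<psi> :: "'k \<Rightarrow> 'h::{complex_ip, complete_space}" and a b :: real
  assumes a: "0 < a" and b: "0 < b"
    and frame_summable: "(\<lambda>k. (cmod (cinner f (\<psi> k)))\<^sup>2) summable_on K"
    and frame_lower: "a * (norm f)\<^sup>2 \<le> (\<Sum>\<^sub>\<infinity>k\<in>K. (cmod (cinner f (\<psi> k)))\<^sup>2)"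
    and frame_upper: "(\<Sum>\<^sub>\<infinity>k\<in>K. (cmod (cinner f (\<psi> k)))\<^sup>2) \<le> b * (norm f)\<^sup>2"
begin

abbreviation "C \<equiv> analysis_op K \<psi>"
abbreviation "D \<equiv> synthesis_op K \<psi>"
abbreviation "S \<equiv> frame_op K \<psi>"

lemma analysis_in_l2: "C f \<in> l2 K"
proof -
  have "(\<lambda>k. (cmod (C f k))\<^sup>2) summable_on K \<longleftrightarrow> (\<lambda>k. (cmod (cinner f (\<psi> k)))\<^sup>2) summable_on K"
    by (intro summable_on_cong) (simp add: analysis_op_def)
  thus ?thesis using frame_summable by (simp add: l2_iff analysis_op_def seqs_def)
qed

text \<open>Duality: pairing g with itself and applying Cauchy-Schwarz leaves the analysis
  coefficients of g, which the upper frame bound controls; one factor \<open>norm g\<close> is then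
  cancelled.\<close>

lemma norm_finite_synthesis:
  assumes F: "finite F" "F \<subseteq> K"
  shows "(norm (\<Sum>k\<in>F. c k *\<^sub>C \<psi> k))\<^sup>2 \<le> b * (\<Sum>k\<in>F. (cmod (c k))\<^sup>2)"
proof -
  define g where "g = (\<Sum>k\<in>F. c k *\<^sub>C \<psi> k)"
  define s where "s = (\<Sum>k\<in>F. (cmod (c k))\<^sup>2)"
  have s: "0 \<le> s" by (simp add: s_def sum_nonneg)
  have "(norm g)\<^sup>2 = cmod (cinner g g)" by (simp add: cinner_self norm_power)
  also have "cinner g g = (\<Sum>k\<in>F. c k * cinner (\<psi> k) g)"
    by (subst (1) g_def) (simp add: cinner_sum_left cinner_scaleC_left)
  also have "cmod \<dots> \<le> (\<Sum>k\<in>F. cmod (c k) * cmod (cinner g (\<psi> k)))"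
  proof -
    have "cmod (cinner (\<psi> k) g) = cmod (cinner g (\<psi> k))" for k
      by (metis cinner_commute complex_mod_cnj)
    thus ?thesis using norm_sum[of "\<lambda>k. c k * cinner (\<psi> k) g" F] by (simp add: norm_mult)
  qed
  also have "\<dots> \<le> L2_set (\<lambda>k. cmod (c k)) F * L2_set (\<lambda>k. cmod (cinner g (\<psi> k))) F"
    using L2_set_mult_ineq[of "\<lambda>k. cmod (c k)" "\<lambda>k. cmod (cinner g (\<psi> k))" F] by simp
  also have "\<dots> \<le> sqrt s * sqrt (b * (norm g)\<^sup>2)"
  proof -
    have "(\<Sum>k\<in>F. (cmod (cinner g (\<psi> k)))\<^sup>2) \<le> (\<Sum>\<^sub>\<infinity>k\<in>K. (cmod (cinner g (\<psi> k)))\<^sup>2)"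
      using F by (intro finite_sum_le_infsum frame_summable) auto
    also have "\<dots> \<le> b * (norm g)\<^sup>2" by (rule frame_upper)
    finally show ?thesis
      unfolding L2_set_def s_def by (intro mult_left_mono) (auto simp: sum_nonneg)
  qed
  also have "\<dots> = sqrt (b * s) * norm g"
    by (simp add: real_sqrt_mult)
  finally have "norm g * norm g \<le> sqrt (b * s) * norm g" by (simp add: power2_eq_square)
  hence "norm g \<le> sqrt (b * s)"
    using b s by (cases "norm g = 0") (auto simp: mult_le_cancel_right)
  hence "(norm g)\<^sup>2 \<le> (sqrt (b * s))\<^sup>2" by (intro power_mono) auto
  thus ?thesis using b s by (simp add: g_def s_def)
qed

lemma synthesis_has_sum:
  assumes c: "c \<in> l2 K"
  shows "((\<lambda>k. c k *\<^sub>C \<psi> k) has_sum D c) K"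
proof -
  have sc: "(\<lambda>k. (cmod (c k))\<^sup>2) summable_on K" using c by (simp add: l2_iff)
  have "(\<lambda>k. c k *\<^sub>C \<psi> k) summable_on K"
  proof (rule summable_on_Cauchy_criterion)
    fix e :: real assume e: "0 < e"
    \<comment> \<open>Chosen so that b * d is the square of e / 2; the factor 1/2 makes the final
      inequality strict.\<close>
    define d where "d = e\<^sup>2 / (4 * b)"
    have d: "d > 0" using e b by (simp add: d_def)
    obtain F0 where F0: "finite F0" "F0 \<subseteq> K"
      "dist (\<Sum>k\<in>F0. (cmod (c k))\<^sup>2) (\<Sum>\<^sub>\<infinity>k\<in>K. (cmod (c k))\<^sup>2) \<le> d"
      using infsum_finite_approximation[OF sc d] by blast
    have "norm (\<Sum>k\<in>F. c k *\<^sub>C \<psi> k) < e" if F: "finite F" "F \<subseteq> K - F0" for F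
    proof -
      have "(norm (\<Sum>k\<in>F. c k *\<^sub>C \<psi> k))\<^sup>2 \<le> b * (\<Sum>k\<in>F. (cmod (c k))\<^sup>2)"
        using F by (intro norm_finite_synthesis) auto
      also have "(\<Sum>k\<in>F. (cmod (c k))\<^sup>2) = (\<Sum>k\<in>F \<union> F0. (cmod (c k))\<^sup>2) - (\<Sum>k\<in>F0. (cmod (c k))\<^sup>2)"
        using F F0 by (subst sum.union_disjoint) auto
      also have "(\<Sum>k\<in>F \<union> F0. (cmod (c k))\<^sup>2) \<le> (\<Sum>\<^sub>\<infinity>k\<in>K. (cmod (c k))\<^sup>2)"
        using F F0 by (intro finite_sum_le_infsum sc) auto
      also have "(\<Sum>\<^sub>\<infinity>k\<in>K. (cmod (c k))\<^sup>2) - (\<Sum>k\<in>F0. (cmod (c k))\<^sup>2) \<le> d"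
        using F0(3) by (simp add: dist_real_def)
      also have "b * d = (e / 2)\<^sup>2"
        using b by (simp add: d_def power_divide)
      finally have "(norm (\<Sum>k\<in>F. c k *\<^sub>C \<psi> k))\<^sup>2 \<le> (e / 2)\<^sup>2"
        using b by (simp add: mult_left_mono)
      hence "norm (\<Sum>k\<in>F. c k *\<^sub>C \<psi> k) \<le> e / 2"
        using e by (simp add: power2_le_iff_abs_le)
      thus ?thesis using e by simp
    qed
    thus "\<exists>F0. finite F0 \<and> F0 \<subseteq> K \<and>
        (\<forall>F. finite F \<longrightarrow> F \<subseteq> K - F0 \<longrightarrow> norm (\<Sum>k\<in>F. c k *\<^sub>C \<psi> k) < e)"
      using F0 by blast
  qed
  thus ?thesis unfolding synthesis_op_def by (rule has_sum_infsum)
qed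

lemma norm_synthesis:
  assumes c: "c \<in> l2 K"
  shows "(norm (D c))\<^sup>2 \<le> b * (\<Sum>\<^sub>\<infinity>k\<in>K. (cmod (c k))\<^sup>2)"
proof (rule tendsto_upperbound)
  have sc: "(\<lambda>k. (cmod (c k))\<^sup>2) summable_on K" using c by (simp add: l2_iff)
  show "((\<lambda>F. (norm (\<Sum>k\<in>F. c k *\<^sub>C \<psi> k))\<^sup>2) \<longlongrightarrow> (norm (D c))\<^sup>2) (finite_subsets_at_top K)"
    using synthesis_has_sum[OF c] unfolding has_sum_def by (intro tendsto_intros)
  show "\<forall>\<^sub>F F in finite_subsets_at_top K.
      (norm (\<Sum>k\<in>F. c k *\<^sub>C \<psi> k))\<^sup>2 \<le> b * (\<Sum>\<^sub>\<infinity>k\<in>K. (cmod (c k))\<^sup>2)"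
  proof (rule eventually_finite_subsets_at_top_weakI)
    fix F assume F: "finite F" "F \<subseteq> K"
    have "(norm (\<Sum>k\<in>F. c k *\<^sub>C \<psi> k))\<^sup>2 \<le> b * (\<Sum>k\<in>F. (cmod (c k))\<^sup>2)"
      using F by (rule norm_finite_synthesis)
    also have "\<dots> \<le> b * (\<Sum>\<^sub>\<infinity>k\<in>K. (cmod (c k))\<^sup>2)"
      using F b by (intro mult_left_mono finite_sum_le_infsum sc) auto
    finally show "(norm (\<Sum>k\<in>F. c k *\<^sub>C \<psi> k))\<^sup>2 \<le> b * (\<Sum>\<^sub>\<infinity>k\<in>K. (cmod (c k))\<^sup>2)" .
  qed
qed simp

lemma cinner_synthesis_has_sum:
  assumes "c \<in> l2 K"
  shows "((\<lambda>k. c k * cinner (\<psi> k) g) has_sum cinner (D c) g) K"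
  using has_sum_bounded_linear[OF bounded_linear_cinner_left synthesis_has_sum[OF assms]]
  by (simp add: cinner_scaleC_left)

lemma synthesis_add:
  assumes c: "c \<in> l2 K" and d: "d \<in> l2 K"
  shows "D (\<lambda>k. c k + d k) = D c + D d"
  using has_sum_add[OF synthesis_has_sum[OF c] synthesis_has_sum[OF d]]
  unfolding scaleC_add_left[symmetric] synthesis_op_def by (rule infsumI)

lemma synthesis_scale:
  assumes c: "c \<in> l2 K"
  shows "D (\<lambda>k. z * c k) = z *\<^sub>C D c"
  using has_sum_bounded_linear[OF bounded_linear_scaleC_right[of z] synthesis_has_sum[OF c]]
  unfolding scaleC_scaleC synthesis_op_def by (rule infsumI)

lemma analysis_add: "C (f + g) = (\<lambda>k. C f k + C g k)"
  by (auto simp: analysis_op_def cinner_add_left)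

lemma analysis_scale: "C (z *\<^sub>C f) = (\<lambda>k. z * C f k)"
  by (auto simp: analysis_op_def cinner_scaleC_left)

lemma frame_op_add: "S (f + g) = S f + S g"
  by (simp add: frame_op_def analysis_add synthesis_add analysis_in_l2)

lemma frame_op_scale: "S (z *\<^sub>C f) = z *\<^sub>C S f"
  by (simp add: frame_op_def analysis_scale synthesis_scale analysis_in_l2)

lemma frame_op_has_sum: "((\<lambda>k. cinner f (\<psi> k) *\<^sub>C \<psi> k) has_sum S f) K"
  using synthesis_has_sum[OF analysis_in_l2[of f]] unfolding frame_op_def
  by (rule has_sum_cong[THEN iffD1, rotated]) (simp add: analysis_op_def)

lemma cinner_frame_op_has_sum: "((\<lambda>k. cinner f (\<psi> k) * cinner (\<psi> k) g) has_sum cinner (S f) g) K"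
  using has_sum_bounded_linear[OF bounded_linear_cinner_left frame_op_has_sum]
  by (simp add: cinner_scaleC_left)

lemma cinner_frame_op_self:
  "cinner (S f) f = of_real (\<Sum>\<^sub>\<infinity>k\<in>K. (cmod (cinner f (\<psi> k)))\<^sup>2)"
proof -
  have "cinner f (\<psi> k) * cinner (\<psi> k) f = of_real ((cmod (cinner f (\<psi> k)))\<^sup>2)" for k
    by (metis cinner_commute complex_norm_square)
  moreover have "((\<lambda>k. of_real ((cmod (cinner f (\<psi> k)))\<^sup>2)) has_sum
      complex_of_real (\<Sum>\<^sub>\<infinity>k\<in>K. (cmod (cinner f (\<psi> k)))\<^sup>2)) K"
    by (intro has_sum_of_real has_sum_infsum frame_summable)
  ultimately show ?thesis
    using has_sum_unique[OF cinner_frame_op_has_sum[of f f]] by simp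
qed

lemma frame_op_symmetric: "cinner (S f) g = cinner f (S g)"
proof -
  have "((\<lambda>k. cnj (cinner g (\<psi> k) * cinner (\<psi> k) f)) has_sum cnj (cinner (S g) f)) K"
    using cinner_frame_op_has_sum[of g f] by (simp only: has_sum_cnj_iff)
  moreover have "cnj (cinner g (\<psi> k) * cinner (\<psi> k) f) = cinner f (\<psi> k) * cinner (\<psi> k) g" for k
    by (metis cinner_commute complex_cnj_mult mult.commute)
  ultimately show ?thesis
    using has_sum_unique[OF cinner_frame_op_has_sum[of f g]] cinner_commute[of f "S g"] by simp
qed

lemma norm_frame_op_le: "norm (S f) \<le> b * norm f"
proof -
  have "(norm (S f))\<^sup>2 \<le> b * (\<Sum>\<^sub>\<infinity>k\<in>K. (cmod (C f k))\<^sup>2)"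
    unfolding frame_op_def by (intro norm_synthesis analysis_in_l2)
  also have "(\<Sum>\<^sub>\<infinity>k\<in>K. (cmod (C f k))\<^sup>2) = (\<Sum>\<^sub>\<infinity>k\<in>K. (cmod (cinner f (\<psi> k)))\<^sup>2)"
    by (intro infsum_cong) (simp add: analysis_op_def)
  also have "b * \<dots> \<le> b * (b * (norm f)\<^sup>2)"
    using b frame_upper by (intro mult_left_mono) auto
  finally have "(norm (S f))\<^sup>2 \<le> (b * norm f)\<^sup>2"
    by (simp add: power2_eq_square mult_ac)
  thus ?thesis using b by (simp add: power2_le_iff_abs_le)
qed

lemma frame_op_lower: "a * (norm f)\<^sup>2 \<le> Re (cinner (S f) f)"
  using frame_lower by (simp add: cinner_frame_op_self)

lemma norm_frame_op_ge: "a * norm f \<le> norm (S f)"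
proof (cases "f = 0")
  case False
  have "a * (norm f)\<^sup>2 \<le> norm (S f) * norm f"
    using frame_op_lower[of f] complex_Re_le_cmod[of "cinner (S f) f"] cinner_cauchy_schwarz[of "S f" f]
    by linarith
  thus ?thesis using False by (simp add: power2_eq_square)
qed simp

lemma frame_op_diff: "S (f - g) = S f - S g"
  using frame_op_add[of f "- g"] frame_op_scale[of "-1" g] by (simp add: scaleC_minus_one)

text \<open>Surjectivity comes from Banach's fixed point theorem: a solution of S f = g is a fixed
  point of f - t (S f - g), a contraction for suitable t because S is symmetric and bounded
  below.\<close>

lemma bij_frame_op: "bij S"
proof (rule bijI)
  show "inj S"
  proof (rule injI)
    fix f g assume "S f = S g"
    hence "a * norm (f - g) \<le> 0" using norm_frame_op_ge[of "f - g"] by (simp add: frame_op_diff)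
    thus "f = g" using a by (simp add: mult_le_0_iff)
  qed
  show "surj S"
  proof (rule surjI)
    fix g
    \<comment> \<open>Minimises the factor 1 - 2 t a + t^2 b^2 that arises below.\<close>
    define t where "t = a / b\<^sup>2"
    have t: "t > 0" using a b by (simp add: t_def)
    \<comment> \<open>The maximum guards against a > b, which the frame inequalities permit on the
      zero space.\<close>
    define c where "c = sqrt (max 0 (1 - a\<^sup>2 / b\<^sup>2))"
    have c: "0 \<le> c" "c < 1"
      using a b by (auto simp: c_def)
    have contr: "norm (f - t *\<^sub>R S f) \<le> c * norm f" for f
    proof -
      have "of_real ((norm (f - t *\<^sub>R S f))\<^sup>2) = cinner (f - t *\<^sub>R S f) (f - t *\<^sub>R S f)"
        by (simp only: cinner_self)
      also have "\<dots> = of_real ((norm f)\<^sup>2) - of_real (2 * t) * cinner (S f) f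
          + of_real (t\<^sup>2 * (norm (S f))\<^sup>2)"
        by (simp add: cinner_diff_left cinner_diff_right cinner_scaleR_left cinner_scaleR_right
            cinner_self[of f] cinner_self[of "S f"] frame_op_symmetric[of f f] algebra_simps power2_eq_square)
      finally have "(norm (f - t *\<^sub>R S f))\<^sup>2
          = Re (of_real ((norm f)\<^sup>2) - of_real (2 * t) * cinner (S f) f + of_real (t\<^sup>2 * (norm (S f))\<^sup>2))"
        by (metis Re_complex_of_real)
      also have "\<dots> = (norm f)\<^sup>2 - 2 * t * Re (cinner (S f) f) + t\<^sup>2 * (norm (S f))\<^sup>2"
        by simp
      also have "\<dots> \<le> (norm f)\<^sup>2 - 2 * t * (a * (norm f)\<^sup>2) + t\<^sup>2 * (b * norm f)\<^sup>2"
        using t frame_op_lower[of f] norm_frame_op_le[of f]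
        by (intro add_mono diff_mono mult_left_mono power_mono) auto
      also have "\<dots> = (1 - a\<^sup>2 / b\<^sup>2) * (norm f)\<^sup>2"
        using a b by (simp add: t_def field_simps power2_eq_square)
      also have "\<dots> \<le> max 0 (1 - a\<^sup>2 / b\<^sup>2) * (norm f)\<^sup>2"
        by (intro mult_right_mono) auto
      also have "\<dots> = (c * norm f)\<^sup>2"
        by (simp add: c_def power_mult_distrib)
      finally show ?thesis
        using c by (simp add: power2_le_iff_abs_le)
    qed
    define G where "G = (\<lambda>f. f - t *\<^sub>R (S f - g))"
    have "dist (G x) (G y) \<le> c * dist x y" for x y
    proof -
      have "G x - G y = (x - y) - t *\<^sub>R S (x - y)"
        by (simp add: G_def frame_op_diff algebra_simps)
      thus ?thesis using contr[of "x - y"] by (simp add: dist_norm)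
    qed
    hence "\<exists>!f. G f = f" using c by (intro banach_fix_type) auto
    then obtain f where "G f = f" by blast
    hence "S f = g" using t by (simp add: G_def)
    thus "S (SOME f. S f = g) = g" by (rule someI)
  qed
qed

section \<open>The inverse and the resolvent of the frame operator\<close>

definition T :: "'h \<Rightarrow> 'h" where "T = inv S"

lemma frame_op_T [simp]: "S (T g) = g"
  unfolding T_def using bij_frame_op by (simp add: bij_is_surj surj_f_inv_f)

lemma T_frame_op [simp]: "T (S g) = g"
  unfolding T_def using bij_frame_op by (simp add: bij_is_inj)

lemma T_eqI: "S f = g \<Longrightarrow> T g = f"
  by auto

lemma T_add: "T (f + g) = T f + T g"
  by (rule T_eqI) (simp add: frame_op_add)

lemma T_diff: "T (f - g) = T f - T g"
  by (rule T_eqI) (simp add: frame_op_diff)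

lemma T_scale: "T (z *\<^sub>C f) = z *\<^sub>C T f"
  by (rule T_eqI) (simp add: frame_op_scale)

lemma norm_T_le: "norm (T f) \<le> norm f / a"
  using norm_frame_op_ge[of "T f"] a by (simp add: field_simps)

lemma bounded_clinear_T: "bounded_clinear T"
  by (rule bounded_clinearI[where M = "1 / a"]) (use norm_T_le in \<open>auto simp: T_add T_scale\<close>)

lemma T_symmetric: "cinner (T f) g = cinner f (T g)"
  using frame_op_symmetric[of "T f" "T g"] by simp

lemma dual_frame_eq: "dual_frame K \<psi> k = T (\<psi> k)"
  by (simp add: dual_frame_def T_def)

text \<open>The resolvent of the frame operator, in the variable \<open>z = 1/u\<close> of \<open>(u - S)\<^sup>-\<^sup>1 = z (1 - z S)\<^sup>-\<^sup>1\<close>.\<close>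

definition V :: "complex \<Rightarrow> 'h \<Rightarrow> 'h" where
  "V z = inv (\<lambda>f. f - z *\<^sub>C S f)"

text \<open>In terms of u = 1/z the condition reads 0 < |u| < a: a punctured disc around 0 that
  avoids the spectrum of S, since the lower frame bound is a.\<close>

context
  fixes z :: complex
  assumes z: "1 < a * cmod z"
begin

text \<open>Rewritten as f = (1/z) T (f - g), the equation is a fixed point problem with Lipschitz
  constant 1/(a |z|) < 1.\<close>

lemma ex1_resolvent: "\<exists>!f. f - z *\<^sub>C S f = g"
proof -
  have z0: "z \<noteq> 0" using z by auto
  define G where "G = (\<lambda>f. (1 / z) *\<^sub>C T (f - g))"
  have eq: "G f = f \<longleftrightarrow> f - z *\<^sub>C S f = g" for f
  proof
    assume "G f = f"
    hence "z *\<^sub>C S f = z *\<^sub>C S (G f)" by simp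
    also have "\<dots> = f - g" using z0 by (simp add: G_def frame_op_scale scaleC_scaleC)
    finally show "f - z *\<^sub>C S f = g" by simp
  next
    assume "f - z *\<^sub>C S f = g"
    hence "f - g = z *\<^sub>C S f" by (simp add: algebra_simps)
    thus "G f = f" using z0 by (simp add: G_def T_scale scaleC_scaleC)
  qed
  have "dist (G x) (G y) \<le> 1 / (a * cmod z) * dist x y" for x y
  proof -
    have "G x - G y = (1 / z) *\<^sub>C T (x - y)"
      by (simp add: G_def T_diff scaleC_diff_right)
    hence "dist (G x) (G y) = norm (T (x - y)) / cmod z"
      by (simp add: dist_norm norm_divide)
    also have "\<dots> \<le> norm (x - y) / a / cmod z"
      by (intro divide_right_mono norm_T_le) auto
    finally show ?thesis by (simp add: dist_norm)
  qed
  moreover have "0 \<le> 1 / (a * cmod z)" "1 / (a * cmod z) < 1" using z a by (auto simp: field_simps)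
  ultimately have "\<exists>!f. G f = f" by (intro banach_fix_type) auto
  thus ?thesis by (simp add: eq)
qed

lemma V_eq: "V z g - z *\<^sub>C S (V z g) = g"
proof -
  have "surj (\<lambda>f. f - z *\<^sub>C S f)" unfolding surj_def using ex1_resolvent by metis
  thus ?thesis unfolding V_def by (rule surj_f_inv_f)
qed

lemma V_eqI: "f - z *\<^sub>C S f = g \<Longrightarrow> V z g = f"
  using ex1_resolvent[of g] V_eq[of g] by blast

lemma V_add: "V z (f + g) = V z f + V z g"
proof (rule V_eqI)
  have "V z f + V z g - z *\<^sub>C S (V z f + V z g)
      = (V z f - z *\<^sub>C S (V z f)) + (V z g - z *\<^sub>C S (V z g))"
    by (simp add: frame_op_add scaleC_add_right)
  thus "V z f + V z g - z *\<^sub>C S (V z f + V z g) = f + g" by (simp add: V_eq)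
qed

lemma V_scale: "V z (s *\<^sub>C f) = s *\<^sub>C V z f"
proof (rule V_eqI)
  have "s *\<^sub>C V z f - z *\<^sub>C S (s *\<^sub>C V z f) = s *\<^sub>C (V z f - z *\<^sub>C S (V z f))"
    by (simp add: frame_op_scale scaleC_diff_right scaleC_scaleC mult.commute)
  thus "s *\<^sub>C V z f - z *\<^sub>C S (s *\<^sub>C V z f) = s *\<^sub>C f" by (simp add: V_eq)
qed

text \<open>\<open>T\<close> applied to the defining equation of \<open>V\<close>. Both the norm
  bound of \<open>V\<close> and its expansion in powers of 1/z rest on this relation.\<close>

lemma V_T: "z *\<^sub>C V z g = T (V z g) - T g"
proof -
  have "T g = T (V z g - z *\<^sub>C S (V z g))" by (simp add: V_eq)
  also have "\<dots> = T (V z g) - z *\<^sub>C V z g" by (simp add: T_diff T_scale)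
  finally show ?thesis by simp
qed

lemma norm_V_le: "norm (V z g) \<le> norm g / (a * cmod z - 1)"
proof -
  have "cmod z * norm (V z g) = norm (T (V z g - g))"
    using V_T[of g] by (simp add: T_diff flip: norm_scaleC)
  also have "\<dots> \<le> norm (V z g - g) / a" by (rule norm_T_le)
  also have "\<dots> \<le> (norm (V z g) + norm g) / a"
    using a by (intro divide_right_mono norm_triangle_ineq4) auto
  finally have "(a * cmod z - 1) * norm (V z g) \<le> norm g"
    using a by (simp add: field_simps)
  thus ?thesis using z by (simp add: field_simps)
qed

lemma bounded_clinear_V: "bounded_clinear (V z)"
  by (rule bounded_clinearI[where M = "1 / (a * cmod z - 1)"])
     (use norm_V_le in \<open>auto simp: V_add V_scale\<close>)

end

text \<open>The S between the two resolvents is what makes the right-hand side a product of matrices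
  after passing to \<open>op_mat\<close>.\<close>

lemma V_resolvent_identity:
  assumes "1 < a * cmod z" "1 < a * cmod y"
  shows "V y x - V z x = (y - z) *\<^sub>C V y (S (V z x))"
proof -
  define f where "f = V z x"
  have "x = (f - y *\<^sub>C S f) + (y - z) *\<^sub>C S f"
    using V_eq[OF assms(1), of x] by (simp add: f_def scaleC_diff_left)
  hence "V y x = V y (f - y *\<^sub>C S f) + (y - z) *\<^sub>C V y (S f)"
    by (metis V_add[OF assms(2)] V_scale[OF assms(2)])
  also have "V y (f - y *\<^sub>C S f) = f"
    by (rule V_eqI[OF assms(2)]) simp
  finally show ?thesis by (simp add: f_def)
qed

end

section \<open>Circle means of the resolvent\<close>

context hilbert_frame
begin

text \<open>The matrix of the operator C X D on sequences: the identity X gives the Gram matrix, and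
  \<open>T\<close> gives the cross-Gram matrix with the dual frame.\<close>

definition op_mat :: "('h \<Rightarrow> 'h) \<Rightarrow> 'k cmat" where
  "op_mat X = (\<lambda>k l. if k \<in> K \<and> l \<in> K then cinner (X (\<psi> l)) (\<psi> k) else 0)"

text \<open>In (C X D)(C Y D) the inner factor D C is S; entrywise this is the frame expansion of S
  (Y \<psi>_l) pushed through X.\<close>

lemma op_mat_mult:
  assumes X: "bounded_clinear X"
  shows "mat_mult K (op_mat X) (op_mat Y) = op_mat (\<lambda>x. X (S (Y x)))"
proof (intro ext)
  fix k l
  show "mat_mult K (op_mat X) (op_mat Y) k l = op_mat (\<lambda>x. X (S (Y x))) k l"
  proof (cases "k \<in> K \<and> l \<in> K")
    case True
    have "((\<lambda>j. X (cinner (Y (\<psi> l)) (\<psi> j) *\<^sub>C \<psi> j)) has_sum X (S (Y (\<psi> l)))) K"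
      using X by (intro has_sum_bounded_linear[OF _ frame_op_has_sum]) (simp add: bounded_clinear_def)
    from has_sum_bounded_linear[OF bounded_linear_cinner_left this, of "\<psi> k"]
    have "((\<lambda>j. cinner (Y (\<psi> l)) (\<psi> j) * cinner (X (\<psi> j)) (\<psi> k)) has_sum
        cinner (X (S (Y (\<psi> l)))) (\<psi> k)) K"
      using X by (simp add: bounded_clinear_def cinner_scaleC_left)
    also have "?this \<longleftrightarrow> ((\<lambda>j. op_mat X k j * op_mat Y j l) has_sum
        cinner (X (S (Y (\<psi> l)))) (\<psi> k)) K"
      using True by (intro has_sum_cong) (simp add: op_mat_def)
    finally show ?thesis
      using True by (simp add: mat_mult_def infsumI op_mat_def)
  next
    case False
    hence "op_mat X k j * op_mat Y j l = 0" for j by (auto simp: op_mat_def)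
    thus ?thesis using False by (auto simp: mat_mult_def op_mat_def)
  qed
qed

lemma op_mat_scale: "op_mat (\<lambda>x. z *\<^sub>C X x) = (\<lambda>k l. z * op_mat X k l)"
  by (intro ext) (simp add: op_mat_def cinner_scaleC_left)

lemma op_mat_diff: "op_mat (\<lambda>x. X x - Y x) = (\<lambda>k l. op_mat X k l - op_mat Y k l)"
  by (intro ext) (simp add: op_mat_def cinner_diff_left)

lemma cross_gram_dual_eq: "cross_gram K (dual_frame K \<psi>) \<psi> = op_mat T"
  by (simp add: cross_gram_def op_mat_def dual_frame_eq T_symmetric fun_eq_iff)

section \<open>Neumann expansion and means over roots of unity\<close>

lemma T_pow_add: "(T ^^ n) (f + g) = (T ^^ n) f + (T ^^ n) g"
  by (induction n) (simp_all add: T_add)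

lemma T_pow_scale: "(T ^^ n) (z *\<^sub>C f) = z *\<^sub>C (T ^^ n) f"
  by (induction n) (simp_all add: T_scale)

lemma T_pow_sum: "(T ^^ n) (\<Sum>i\<in>I. f i) = (\<Sum>i\<in>I. (T ^^ n) (f i))"
proof -
  have "(T ^^ n) 0 = 0" using T_pow_scale[of n 0 0] by simp
  thus ?thesis by (induction I rule: infinite_finite_induct) (auto simp: T_pow_add)
qed

lemma norm_T_pow_le: "norm ((T ^^ n) f) \<le> norm f / a ^ n"
proof (induction n)
  case (Suc n)
  have "norm ((T ^^ Suc n) f) \<le> norm ((T ^^ n) f) / a" using norm_T_le by simp
  also have "\<dots> \<le> norm f / a ^ n / a" using Suc a by (intro divide_right_mono) auto
  finally show ?case by (simp add: mult.commute)
qed simp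

text \<open>N iterations of \<open>V_T\<close>: a finite Neumann series in 1/z with exact remainder,
  so no infinite operator series arises.\<close>

lemma resolvent_expansion:
  assumes z: "1 < a * cmod z"
  shows "z *\<^sub>C V z g = - (\<Sum>n<N. inverse z ^ n *\<^sub>C (T ^^ Suc n) g) + inverse z ^ N *\<^sub>C (T ^^ N) (z *\<^sub>C V z g)"
proof (induction N)
  case (Suc N)
  have z0: "z \<noteq> 0" using z by auto
  have "z *\<^sub>C V z g = (-1) *\<^sub>C T g + inverse z *\<^sub>C T (z *\<^sub>C V z g)"
  proof -
    have "inverse z *\<^sub>C T (z *\<^sub>C V z g) = T (V z g)"
      using z0 by (simp add: T_scale scaleC_scaleC)
    thus ?thesis by (simp add: V_T[OF z, of g] scaleC_minus_one)
  qed
  hence "(T ^^ N) (z *\<^sub>C V z g) = (T ^^ N) ((-1) *\<^sub>C T g + inverse z *\<^sub>C T (z *\<^sub>C V z g))"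
    by simp
  also have "\<dots> = - (T ^^ Suc N) g + inverse z *\<^sub>C (T ^^ Suc N) (z *\<^sub>C V z g)"
    by (simp only: T_pow_add T_pow_scale funpow_Suc_right o_apply) (simp only: scaleC_minus_one)
  finally have "inverse z ^ N *\<^sub>C (T ^^ N) (z *\<^sub>C V z g) =
      inverse z ^ N *\<^sub>C (- (T ^^ Suc N) g + inverse z *\<^sub>C (T ^^ Suc N) (z *\<^sub>C V z g))"
    by (rule arg_cong)
  also have "\<dots> = - (inverse z ^ N *\<^sub>C (T ^^ Suc N) g)
      + inverse z ^ Suc N *\<^sub>C (T ^^ Suc N) (z *\<^sub>C V z g)"
    by (simp add: scaleC_diff_right scaleC_scaleC mult.commute)
  finally have step: "inverse z ^ N *\<^sub>C (T ^^ N) (z *\<^sub>C V z g) =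
      - (inverse z ^ N *\<^sub>C (T ^^ Suc N) g) + inverse z ^ Suc N *\<^sub>C (T ^^ Suc N) (z *\<^sub>C V z g)" .
  show ?case
    by (subst Suc, subst step) (simp del: funpow.simps power_Suc)
qed simp

text \<open>In u = 1/z this is the circle of radius a/2, halfway between 0 and the lower frame
  bound; there a |z| - 1 = 1, which keeps the constants simple. One turn corresponds to t in the
  unit interval.\<close>

definition circ :: "real \<Rightarrow> complex" where
  "circ t = of_real (2 / a) * cis (2 * pi * t)"

lemma norm_circ: "cmod (circ t) = 2 / a"
  using a by (simp add: circ_def norm_mult norm_divide)

lemma inverse_circ: "inverse (circ t) = of_real (a / 2) * cis (- (2 * pi * t))"
  unfolding circ_def inverse_mult_distrib cis_inverse by simp

lemma circ_admissible: "1 < a * cmod (circ t)"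
  using a by (simp add: norm_circ)

text \<open>Up to the factor (a/2)^n this is a geometric sum over an N-th root of unity \<omega>,
  and \<omega> differs from 1 because N does not divide n.\<close>

lemma sum_circ_powers:
  assumes n: "0 < n" "n < N"
  shows "(\<Sum>j<N. inverse (circ (real j / real N)) ^ n) = 0"
proof -
  define \<omega> where "\<omega> = cis (- (2 * pi * real n / real N))"
  have "inverse (circ (real j / real N)) ^ n = of_real (a / 2) ^ n * \<omega> ^ j" for j
  proof -
    have "real n * (- (2 * pi * (real j / real N))) = real j * (- (2 * pi * real n / real N))"
      by simp
    thus ?thesis unfolding inverse_circ \<omega>_def power_mult_distrib Complex.DeMoivre by (simp only:)
  qed
  hence "(\<Sum>j<N. inverse (circ (real j / real N)) ^ n) = of_real (a / 2) ^ n * (\<Sum>j<N. \<omega> ^ j)"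
    by (simp add: sum_distrib_left)
  moreover have "\<omega> \<noteq> 1"
  proof
    assume "\<omega> = 1"
    hence "cos (2 * pi * real n / real N) = 1" by (simp add: \<omega>_def complex_eq_iff)
    then obtain m :: int where "2 * pi * real n / real N = of_int m * 2 * pi"
      using cos_one_2pi_int by auto
    hence "real n = of_int m * real N" using n by (simp add: field_simps)
    hence "int n = m * int N" by (metis of_int_eq_iff of_int_mult of_int_of_nat_eq)
    hence "int N dvd int n" by simp
    thus False using n by (auto dest: dvd_imp_le)
  qed
  moreover have "\<omega> ^ N = 1"
  proof -
    have "\<omega> ^ N = inverse (cis (2 * pi * real n))"
    proof -
      have "real N * (- (2 * pi * real n / real N)) = - (2 * pi * real n)" using n by simp
      thus ?thesis unfolding \<omega>_def Complex.DeMoivre cis_inverse by (simp only:)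
    qed
    thus ?thesis by (simp add: cis_multiple_2pi del: cis_inverse)
  qed
  ultimately show ?thesis by (simp add: geometric_sum)
qed

text \<open>\<open>z *\<^sub>C V z\<close> is the resolvent of S at u = 1/z, an analytic function of
  u whose value at the centre u = 0 is - T.\<close>

definition circ_mean :: "nat \<Rightarrow> 'h \<Rightarrow> 'h" where
  "circ_mean N g = (1 / of_nat N) *\<^sub>C (\<Sum>j<N. circ (real j / real N) *\<^sub>C V (circ (real j / real N)) g)"

text \<open>Mean value property of \<open>u \<mapsto> (u - S)\<^sup>-\<^sup>1\<close> on the disc of radius \<open>a / 2\<close>, discretised.\<close>

lemma circ_mean_approx:
  assumes N: "0 < N"
  shows "norm (circ_mean N g + T g) \<le> 2 / a * norm g * (1 / 2) ^ N"
proof -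
  define z where "z = (\<lambda>j. circ (real j / real N))"
  define Z where "Z = (\<lambda>j. z j *\<^sub>C V (z j) g)"
  have z: "1 < a * cmod (z j)" for j by (simp add: z_def circ_admissible)
  \<comment> \<open>All N-th powers coincide on the N equally spaced points, so the remainders of
    the expansions combine into one operator applied to the mean.\<close>
  have zN: "inverse (z j) ^ N = of_real (a / 2) ^ N" for j
  proof -
    have "inverse (z j) ^ N = of_real (a / 2) ^ N * inverse (cis (2 * pi * real j))"
    proof -
      have "real N * (- (2 * pi * (real j / real N))) = - (2 * pi * real j)"
        using N by simp
      thus ?thesis unfolding z_def inverse_circ power_mult_distrib Complex.DeMoivre cis_inverse by (simp only:)
    qed
    also have "cis (2 * pi * real j) = 1" by (simp add: cis_multiple_2pi)
    finally show ?thesis by simp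
  qed
  have "(\<Sum>j<N. Z j) = (\<Sum>j<N. - (\<Sum>n<N. inverse (z j) ^ n *\<^sub>C (T ^^ Suc n) g)
      + of_real (a / 2) ^ N *\<^sub>C (T ^^ N) (Z j))"
  proof (rule sum.cong[OF refl])
    show "Z j = - (\<Sum>n<N. inverse (z j) ^ n *\<^sub>C (T ^^ Suc n) g)
      + of_real (a / 2) ^ N *\<^sub>C (T ^^ N) (Z j)" for j
      unfolding Z_def zN[of j, symmetric] by (rule resolvent_expansion[OF z])
  qed
  also have "\<dots> = - (\<Sum>n<N. (\<Sum>j<N. inverse (z j) ^ n) *\<^sub>C (T ^^ Suc n) g)
      + of_real (a / 2) ^ N *\<^sub>C (T ^^ N) (\<Sum>j<N. Z j)"
  proof -
    have *: "(\<Sum>j\<in>J. s j) *\<^sub>C x = (\<Sum>j\<in>J. s j *\<^sub>C x)" for J :: "nat set" and s and x :: 'h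
      by (induction J rule: infinite_finite_induct) (auto simp: scaleC_add_left)
    have **: "s *\<^sub>C (\<Sum>j\<in>J. x j) = (\<Sum>j\<in>J. s *\<^sub>C x j)" for J :: "nat set" and s and x :: "nat \<Rightarrow> 'h"
      by (induction J rule: infinite_finite_induct) (auto simp: scaleC_add_right)
    show ?thesis
      unfolding sum.distrib sum_negf T_pow_sum * ** by (subst sum.swap) (rule refl)
  qed
  \<comment> \<open>Every power with 0 < n < N sums to zero over the roots of unity; n = 0 leaves
    the value at the centre.\<close>
  also have "(\<Sum>n<N. (\<Sum>j<N. inverse (z j) ^ n) *\<^sub>C (T ^^ Suc n) g)
      = (\<Sum>n\<in>{0}. (\<Sum>j<N. inverse (z j) ^ n) *\<^sub>C (T ^^ Suc n) g)"
    using N by (intro sum.mono_neutral_right) (auto simp: z_def sum_circ_powers)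
  also have "\<dots> = of_nat N *\<^sub>C T g" by simp
  finally have "(1 / of_nat N) *\<^sub>C (\<Sum>j<N. Z j)
      = (1 / of_nat N) *\<^sub>C (- (of_nat N *\<^sub>C T g) + of_real (a / 2) ^ N *\<^sub>C (T ^^ N) (\<Sum>j<N. Z j))"
    by (rule arg_cong)
  also have "\<dots> = - T g + of_real (a / 2) ^ N *\<^sub>C (T ^^ N) ((1 / of_nat N) *\<^sub>C (\<Sum>j<N. Z j))"
    using N by (simp add: scaleC_diff_right T_pow_scale scaleC_scaleC mult.commute)
  finally have eq: "(1 / of_nat N) *\<^sub>C (\<Sum>j<N. Z j)
      = - T g + of_real (a / 2) ^ N *\<^sub>C (T ^^ N) ((1 / of_nat N) *\<^sub>C (\<Sum>j<N. Z j))" .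
  have mean: "circ_mean N g = (1 / of_nat N) *\<^sub>C (\<Sum>j<N. Z j)"
    by (simp add: circ_mean_def Z_def z_def)
  \<comment> \<open>The error is an operator of norm at most (1/2)^N applied to the mean itself, so
    it remains to bound the mean independently of N.\<close>
  have "circ_mean N g + T g = of_real (a / 2) ^ N *\<^sub>C (T ^^ N) (circ_mean N g)"
    unfolding mean by (subst eq) simp
  hence "norm (circ_mean N g + T g) = (a / 2) ^ N * norm ((T ^^ N) (circ_mean N g))"
    using a by (simp add: norm_power norm_divide)
  also have "\<dots> \<le> (a / 2) ^ N * (norm (circ_mean N g) / a ^ N)"
    using a by (intro mult_left_mono norm_T_pow_le) auto
  also have "\<dots> = norm (circ_mean N g) * (1 / 2) ^ N"
    using a by (simp add: power_divide)
  also have "norm (circ_mean N g) \<le> 2 / a * norm g"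
  proof -
    have Z: "norm (Z j) \<le> 2 / a * norm g" for j
    proof -
      have "norm (Z j) = 2 / a * norm (V (z j) g)" by (simp add: Z_def z_def norm_circ)
      also have "\<dots> \<le> 2 / a * (norm g / (a * cmod (z j) - 1))"
        using a by (intro mult_left_mono norm_V_le z) auto
      also have "a * cmod (z j) - 1 = 1" using a by (simp add: z_def norm_circ)
      finally show ?thesis by simp
    qed
    have "norm (\<Sum>j<N. Z j) \<le> (\<Sum>j<N. norm (Z j))" by (rule norm_sum)
    also have "\<dots> \<le> (\<Sum>j<N. 2 / a * norm g)" using Z by (rule sum_mono)
    finally have "norm (\<Sum>j<N. Z j) \<le> real N * (2 / a * norm g)" by simp
    hence "1 / real N * norm (\<Sum>j<N. Z j) \<le> 2 / a * norm g"
      using N by (simp add: field_simps)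
    moreover have "norm (circ_mean N g) = 1 / real N * norm (\<Sum>j<N. Z j)"
      by (simp add: circ_mean_def Z_def z_def norm_divide)
    ultimately show ?thesis by simp
  qed
  finally show ?thesis by (simp add: mult_right_mono)
qed

lemma circ_mean_tendsto: "(\<lambda>N. circ_mean N g) \<longlonglongrightarrow> - T g"
proof -
  have "(\<lambda>N. (1 / 2 :: real) ^ N) \<longlonglongrightarrow> 0" by (rule LIMSEQ_power_zero) simp
  hence "(\<lambda>N. 2 / a * norm g * (1 / 2) ^ N) \<longlonglongrightarrow> 2 / a * norm g * 0"
    by (rule tendsto_mult_left)
  hence lim: "(\<lambda>N. 2 / a * norm g * (1 / 2) ^ N) \<longlonglongrightarrow> 0" by simp
  have "\<forall>\<^sub>F N in sequentially. norm (circ_mean N g + T g) \<le> 2 / a * norm g * (1 / 2) ^ N"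
    by (rule eventually_sequentiallyI[of 1]) (rule circ_mean_approx, simp)
  hence "(\<lambda>N. circ_mean N g + T g) \<longlonglongrightarrow> 0"
    using lim by (rule Lim_null_comparison)
  hence "(\<lambda>N. circ_mean N g + T g - T g) \<longlonglongrightarrow> 0 - T g"
    by (intro tendsto_diff tendsto_const)
  thus ?thesis by simp
qed

end

text \<open>Chord against arc: \<open>cis t - 1\<close> has modulus 2 |sin (t/2)|.\<close>

lemma cmod_cis_diff_le: "cmod (cis x - cis y) \<le> \<bar>x - y\<bar>"
proof -
  have 1: "cmod (cis t - 1) \<le> \<bar>t\<bar>" for t
  proof -
    have "(cmod (cis t - 1))\<^sup>2 = (cos t)\<^sup>2 + (sin t)\<^sup>2 + 1 - 2 * cos t"
      by (simp add: cmod_power2 power2_diff algebra_simps)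
    also have "\<dots> = 2 - 2 * cos (2 * (t / 2))" by (simp add: sin_cos_squared_add2)
    also have "\<dots> = (2 * sin (t / 2))\<^sup>2"
      unfolding cos_double_sin by (simp add: power_mult_distrib)
    finally have "cmod (cis t - 1) = 2 * \<bar>sin (t / 2)\<bar>"
      by (metis abs_mult abs_norm_cancel abs_numeral power2_eq_iff_nonneg abs_ge_zero power2_abs)
    thus ?thesis using abs_sin_x_le_abs_x[of "t / 2"] by simp
  qed
  have "cis x - cis y = cis y * (cis (x - y) - 1)" by (simp add: algebra_simps cis_mult)
  hence "cmod (cis x - cis y) = cmod (cis (x - y) - 1)" by (simp only: norm_mult norm_cis mult_1)
  thus ?thesis using 1 by simp
qed

section \<open>Limits and Riemann sums in the normed matrix algebra\<close>

context solid_spectral_algebra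
begin

lemma diff_closed: "A \<in> \<A> \<Longrightarrow> B \<in> \<A> \<Longrightarrow> (\<lambda>k l. A k l - B k l) \<in> \<A>"
  using add_closed[of A "\<lambda>k l. (-1) * B k l"] scale_closed[of B "-1"] by simp

lemma norm_diff_commute: "A \<in> \<A> \<Longrightarrow> B \<in> \<A> \<Longrightarrow> N (\<lambda>k l. A k l - B k l) = N (\<lambda>k l. B k l - A k l)"
  using norm_scale[of "\<lambda>k l. A k l - B k l" "-1"] diff_closed by simp

lemma norm_of_zero: "N (\<lambda>k l. 0) = 0"
  using norm_zero_iff zero_closed by blast

lemma sum_closed: "(\<And>i. i \<in> I \<Longrightarrow> F i \<in> \<A>) \<Longrightarrow> (\<lambda>k l. \<Sum>i\<in>I. F i k l) \<in> \<A>"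
  by (induction I rule: infinite_finite_induct) (auto simp: zero_closed intro: add_closed)

lemma norm_finite_sum_le:
  "(\<And>i. i \<in> I \<Longrightarrow> F i \<in> \<A>) \<Longrightarrow> N (\<lambda>k l. \<Sum>i\<in>I. F i k l) \<le> (\<Sum>i\<in>I. N (F i))"
proof (induction I rule: infinite_finite_induct)
  case (insert i I)
  have "N (\<lambda>k l. F i k l + (\<Sum>i\<in>I. F i k l)) \<le> N (F i) + N (\<lambda>k l. \<Sum>i\<in>I. F i k l)"
    using insert by (intro norm_triangle sum_closed) auto
  with insert show ?case by fastforce
qed (auto simp: norm_of_zero)

lemma norm_triangle_diff:
  "A \<in> \<A> \<Longrightarrow> B \<in> \<A> \<Longrightarrow> N A \<le> N (\<lambda>k l. A k l - B k l) + N B"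
  using norm_triangle[of "\<lambda>k l. A k l - B k l" B] diff_closed by simp

text \<open>The link from N to entries comes from solidity: if some member has a nonzero
  (k,l)-entry, the matrix unit E at (k,l) belongs to the algebra and A k l * E is dominated by A.
  Otherwise all these entries vanish.\<close>

lemma entry_bound: "\<exists>c. \<forall>A\<in>\<A>. cmod (A k l) \<le> c * N A"
proof (cases "\<exists>B\<in>\<A>. B k l \<noteq> 0")
  case True
  then obtain B where B: "B \<in> \<A>" "B k l \<noteq> 0" by blast
  define E :: "'k cmat" where "E = (\<lambda>i j. if i = k \<and> j = l then 1 else 0)"
  have kl: "k \<in> K" "l \<in> K" using B carrier by (auto simp: mats_def)
  have "E \<in> \<A> \<and> N E \<le> N (\<lambda>i j. inverse (B k l) * B i j)"
    using B kl by (intro solid scale_closed) (auto simp: E_def mats_def norm_mult norm_inverse)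
  hence E: "E \<in> \<A>" ..
  have "E \<noteq> (\<lambda>_ _. 0)" by (auto simp: E_def fun_eq_iff)
  hence NE: "N E > 0" using norm_zero_iff[OF E] norm_nonneg[OF E] by linarith
  have "cmod (A k l) \<le> 1 / N E * N A" if A: "A \<in> \<A>" for A
  proof -
    have "N (\<lambda>i j. A k l * E i j) \<le> N A"
      using A kl by (intro conjunct2[OF solid]) (auto simp: E_def mats_def)
    thus ?thesis using NE E by (simp add: norm_scale field_simps)
  qed
  thus ?thesis by blast
next
  case False
  thus ?thesis by (intro exI[of _ 0]) auto
qed

lemma entry_tendsto:
  assumes "\<And>n. F n \<in> \<A>" "A \<in> \<A>" "(\<lambda>n. N (\<lambda>k l. F n k l - A k l)) \<longlonglongrightarrow> 0"
  shows "(\<lambda>n. F n k l) \<longlonglongrightarrow> A k l"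
proof -
  obtain c where c: "\<And>A. A \<in> \<A> \<Longrightarrow> cmod (A k l) \<le> c * N A" using entry_bound by blast
  have "(\<lambda>n. c * N (\<lambda>k l. F n k l - A k l)) \<longlonglongrightarrow> c * 0"
    by (rule tendsto_mult_left[OF assms(3)])
  hence lim: "(\<lambda>n. c * N (\<lambda>k l. F n k l - A k l)) \<longlonglongrightarrow> 0" by simp
  have "\<forall>\<^sub>F n in sequentially. norm (F n k l - A k l) \<le> c * N (\<lambda>k l. F n k l - A k l)"
    by (intro always_eventually allI c diff_closed assms)
  hence "(\<lambda>n. F n k l - A k l) \<longlonglongrightarrow> 0"
    using lim by (rule Lim_null_comparison)
  thus ?thesis using LIM_zero_iff by blast
qed

text \<open>Plays the role of integrating a Lipschitz curve in the algebra. Refining the dyadic grid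
  makes the means Cauchy in N; the limit obtained by completeness has the same entries as X, since N
  controls entries.\<close>

lemma dyadic_mean_in_algebra:
  assumes \<Phi>: "\<And>t::real. \<Phi> t \<in> \<A>"
    and lip: "\<And>s t. N (\<lambda>k l. \<Phi> s k l - \<Phi> t k l) \<le> L * \<bar>s - t\<bar>"
    and lim: "\<And>k l. (\<lambda>m. \<Sum>j<2 ^ m. (1 / 2 ^ m) * \<Phi> (real j / 2 ^ m) k l) \<longlonglongrightarrow> X k l"
  shows "X \<in> \<A>"
proof -
  define A where "A = (\<lambda>m k l. \<Sum>j<2 ^ m. (1 / 2 ^ m) * \<Phi> (real j / 2 ^ m) k l)"
  have A: "A m \<in> \<A>" for m
    unfolding A_def by (intro sum_closed scale_closed \<Phi>)
  have L: "0 \<le> L"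
    using lip[of 1 0] norm_nonneg[OF diff_closed[OF \<Phi> \<Phi>], of 1 0] by simp
  have step: "N (\<lambda>k l. A (Suc m) k l - A m k l) \<le> L * (1 / 2) ^ m" for m
  proof -
    define c :: complex where "c = 1 / 2 ^ Suc m"
    \<comment> \<open>Even points of the finer grid are points of the coarser one; what remains
      compares each midpoint with the left endpoint of its interval.\<close>
    define \<Delta> where "\<Delta> = (\<lambda>j k l. \<Phi> (real (2 * j + 1) / 2 ^ Suc m) k l - \<Phi> (real j / 2 ^ m) k l)"
    have \<Delta>: "\<Delta> j \<in> \<A>" for j unfolding \<Delta>_def by (intro diff_closed \<Phi>)
    have split: "(\<Sum>i<2 * n. f i) = (\<Sum>j<n. f (2 * j) + f (2 * j + 1))" for n and f :: "nat \<Rightarrow> complex"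
      by (induction n) simp_all
    have "(\<lambda>k l. A (Suc m) k l - A m k l) = (\<lambda>k l. \<Sum>j<2 ^ m. c * \<Delta> j k l)"
    proof (intro ext)
      fix k l
      have "A (Suc m) k l = (\<Sum>j<2 ^ m. c * \<Phi> (real (2 * j) / 2 ^ Suc m) k l
          + c * \<Phi> (real (2 * j + 1) / 2 ^ Suc m) k l)"
        unfolding A_def power_Suc split c_def ..
      moreover have "A m k l = (\<Sum>j<2 ^ m. 2 * c * \<Phi> (real j / 2 ^ m) k l)"
        by (simp add: A_def c_def)
      moreover have "real (2 * j) / 2 ^ Suc m = real j / 2 ^ m" for j by simp
      ultimately have "A (Suc m) k l - A m k l = (\<Sum>j<2 ^ m. c * \<Phi> (real j / 2 ^ m) k l
          + c * \<Phi> (real (2 * j + 1) / 2 ^ Suc m) k l - 2 * c * \<Phi> (real j / 2 ^ m) k l)"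
        by (simp only: sum_subtractf)
      also have "\<dots> = (\<Sum>j<2 ^ m. c * \<Delta> j k l)"
        by (intro sum.cong refl) (simp add: \<Delta>_def algebra_simps)
      finally show "A (Suc m) k l - A m k l = (\<Sum>j<2 ^ m. c * \<Delta> j k l)" .
    qed
    hence "N (\<lambda>k l. A (Suc m) k l - A m k l) \<le> (\<Sum>j<2 ^ m. N (\<lambda>k l. c * \<Delta> j k l))"
      using norm_finite_sum_le[of "{..<2 ^ m}" "\<lambda>j k l. c * \<Delta> j k l"] \<Delta> scale_closed by simp
    \<comment> \<open>There are 2^m terms, each with weight and mesh width 1/2^(m+1), which gives L
      / 2^(m+2).\<close>
    also have "\<dots> \<le> (\<Sum>j<(2::nat) ^ m. (1 / 2 ^ Suc m) * (L * (1 / 2 ^ Suc m)))"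
    proof (rule sum_mono)
      fix j
      have "real (2 * j + 1) / 2 ^ Suc m - real j / 2 ^ m = 1 / 2 ^ Suc m"
        by (simp add: field_simps)
      hence "N (\<Delta> j) \<le> L * (1 / 2 ^ Suc m)"
        using lip[of "real (2 * j + 1) / 2 ^ Suc m" "real j / 2 ^ m"] by (simp add: \<Delta>_def)
      thus "N (\<lambda>k l. c * \<Delta> j k l) \<le> (1 / 2 ^ Suc m) * (L * (1 / 2 ^ Suc m))"
        unfolding norm_scale[OF \<Delta>] by (intro mult_mono') (simp_all add: c_def norm_divide norm_power norm_mult norm_nonneg \<Delta>)
    qed
    also have "\<dots> = L * (1 / 2) ^ m / 4" by (simp add: field_simps)
    also have "\<dots> \<le> L * (1 / 2) ^ m" using L by simp
    finally show ?thesis .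
  qed
  \<comment> \<open>The factor on the right is the exact geometric sum of the step bounds, so the
    induction closes without loss.\<close>
  have tele: "N (\<lambda>k l. A (m + d) k l - A m k l) \<le> 2 * L * ((1 / 2) ^ m - (1 / 2) ^ (m + d))" for m d
  proof (induction d)
    case 0
    thus ?case by (simp add: norm_of_zero)
  next
    case (Suc d)
    have "N (\<lambda>k l. (A (Suc (m + d)) k l - A (m + d) k l) + (A (m + d) k l - A m k l))
        \<le> L * (1 / 2) ^ (m + d) + 2 * L * ((1 / 2) ^ m - (1 / 2) ^ (m + d))"
      using norm_triangle[OF diff_closed[OF A A] diff_closed[OF A A]] step[of "m + d"] Suc
      by (meson add_mono order_trans)
    thus ?case by (simp add: algebra_simps)
  qed
  have close: "N (\<lambda>k l. A n k l - A m k l) \<le> 2 * L * (1 / 2) ^ m" if "m \<le> n" for m n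
  proof -
    have "2 * L * ((1 / 2) ^ m - (1 / 2) ^ n) \<le> 2 * L * (1 / 2) ^ m"
      using L by (intro mult_left_mono) auto
    thus ?thesis using tele[of m "n - m"] that by simp
  qed
  have "\<exists>B\<in>\<A>. (\<lambda>n. N (\<lambda>k l. A n k l - B k l)) \<longlonglongrightarrow> 0"
  proof (rule complete[OF A])
    fix e :: real assume e: "0 < e"
    have "(\<lambda>m. 2 * L * (1 / 2) ^ m) \<longlonglongrightarrow> 2 * L * 0"
      by (intro tendsto_mult tendsto_const LIMSEQ_power_zero) auto
    hence "\<forall>\<^sub>F m in sequentially. 2 * L * (1 / 2) ^ m < e"
      using e order_tendstoD(2)[of _ 0 _ e] by simp
    then obtain M where M: "\<And>m. m \<ge> M \<Longrightarrow> 2 * L * (1 / 2) ^ m < e"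
      by (auto simp: eventually_sequentially)
    have "N (\<lambda>k l. A m k l - A n k l) < e" if "m \<ge> M" "n \<ge> M" for m n
      using close[of m n] close[of n m] M[OF that(1)] M[OF that(2)] norm_diff_commute[OF A A, of m n]
      by (cases "m \<le> n") auto
    thus "\<exists>M. \<forall>m\<ge>M. \<forall>n\<ge>M. N (\<lambda>k l. A m k l - A n k l) < e" by blast
  qed
  then obtain B where B: "B \<in> \<A>" "(\<lambda>n. N (\<lambda>k l. A n k l - B k l)) \<longlonglongrightarrow> 0" by blast
  have "X k l = B k l" for k l
    using lim[of k l] entry_tendsto[OF A B, of k l] unfolding A_def by (rule LIMSEQ_unique)
  hence "X = B" by (intro ext)
  thus ?thesis using B by simp
qed

end

section \<open>The dual Gram matrix lies in the algebra\<close>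

locale localized_hilbert_frame =
  solid_spectral_algebra K \<A> N + hilbert_frame K \<psi> a b
  for K :: "'k set" and \<A> N and \<psi> :: "'k \<Rightarrow> 'h::{complex_ip, complete_space}" and a b :: real +
  fixes \<delta> :: real
  assumes gram_closed: "cross_gram K \<psi> \<psi> \<in> \<A>"
    and \<delta>: "0 < \<delta>"
    and norm_ge: "k \<in> K \<Longrightarrow> \<delta> \<le> norm (\<psi> k)"
begin

definition idmat :: "'k cmat" where
  "idmat = (\<lambda>k l. of_bool (k \<in> K \<and> k = l))"

text \<open>The algebra need not be unital, but the diagonal of the Gram matrix is bounded below.\<close>

lemma idmat_closed: "idmat \<in> \<A>"
proof -
  define G where "G = (\<lambda>k l. of_real (1 / \<delta>\<^sup>2) * cross_gram K \<psi> \<psi> k l)"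
  have "G \<in> \<A>" unfolding G_def by (intro scale_closed gram_closed)
  moreover have "cmod (idmat k l) \<le> cmod (G k l)" for k l
  proof (cases "k \<in> K \<and> k = l")
    case True
    hence "\<delta>\<^sup>2 \<le> (norm (\<psi> k))\<^sup>2" using norm_ge \<delta> by (intro power_mono) auto
    moreover have "cmod (cinner (\<psi> k) (\<psi> k)) = (norm (\<psi> k))\<^sup>2"
      by (simp add: cinner_self norm_power)
    ultimately show ?thesis
      using True \<delta> by (simp add: idmat_def G_def cross_gram_def norm_divide norm_power)
  qed (auto simp: idmat_def)
  moreover have "idmat \<in> mats K" by (auto simp: idmat_def mats_def)
  ultimately show ?thesis using solid by blast
qed

text \<open>Inverse-closedness is applied to \<open>Am\<close>, the matrix 1 - z C D. Its inverse is
  1 + z C \<open>V z\<close> D, and the algebra contains the identity, so C \<open>V z\<close> D can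
  be split off.\<close>

lemma resolvent_closed:
  assumes z: "1 < a * cmod z"
  shows "op_mat (V z) \<in> \<A>"
proof -
  define Am where "Am = (\<lambda>k l. idmat k l - z * cross_gram K \<psi> \<psi> k l)"
  \<comment> \<open>From the identity (1 - z C D)^-1 = 1 + z C (1 - z D C)^-1 D, in which D C =
    S.\<close>
  define R where "R = (\<lambda>c k. c k + z * C (V z (D c)) k)"
  have z0: "z \<noteq> 0" using z by auto
  have Am: "Am \<in> \<A>"
    unfolding Am_def by (intro diff_closed scale_closed idmat_closed gram_closed)
  have l2_add: "(\<lambda>k. c k + s * C f k) \<in> l2 K" if "c \<in> l2 K" for c s f
    by (intro lp_add lp_scale analysis_in_l2 that) auto
  have D_add: "D (\<lambda>k. c k + s * C f k) = D c + s *\<^sub>C S f" if "c \<in> l2 K" for c s f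
  proof -
    have "(\<lambda>k. s * C f k) \<in> l2 K" by (intro lp_scale analysis_in_l2) auto
    thus ?thesis
      using that by (simp add: synthesis_add synthesis_scale analysis_in_l2 frame_op_def)
  qed
  have app: "mat_app K Am c = (\<lambda>k. c k + (- z) * C (D c) k)" if c: "c \<in> l2 K" for c
  proof
    fix k
    show "mat_app K Am c k = c k + (- z) * C (D c) k"
    proof (cases "k \<in> K")
      case True
      have "((\<lambda>l. idmat k l * c l) has_sum c k) K"
        using True by (intro has_sum_finite_neutralI[where B = "{k}"]) (auto simp: idmat_def)
      moreover have "((\<lambda>l. (- z) * (c l * cinner (\<psi> l) (\<psi> k))) has_sum (- z) * cinner (D c) (\<psi> k)) K"
        by (intro has_sum_cmult_right cinner_synthesis_has_sum c)
      ultimately have "((\<lambda>l. idmat k l * c l + (- z) * (c l * cinner (\<psi> l) (\<psi> k))) has_sum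
          (c k + (- z) * cinner (D c) (\<psi> k))) K"
        by (rule has_sum_add)
      also have "?this \<longleftrightarrow> ((\<lambda>l. Am k l * c l) has_sum (c k + (- z) * cinner (D c) (\<psi> k))) K"
        using True by (intro has_sum_cong) (simp add: Am_def cross_gram_def algebra_simps)
      finally show ?thesis
        using True by (simp add: mat_app_def infsumI analysis_op_def)
    next
      case False
      thus ?thesis using c
        by (simp add: mat_app_def Am_def idmat_def cross_gram_def analysis_op_def lp_def seqs_def)
    qed
  qed
  have left: "R (mat_app K Am c) = c" if c: "c \<in> l2 K" for c
  proof -
    have "D (mat_app K Am c) = D c - z *\<^sub>C S (D c)"
      unfolding app[OF c] D_add[OF c] by (simp add: scaleC_minus_left)
    hence "V z (D (mat_app K Am c)) = D c" using V_eqI[OF z] by simp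
    thus ?thesis by (simp add: R_def) (simp add: app[OF c])
  qed
  have DR: "D (R c) = V z (D c)" if c: "c \<in> l2 K" for c
    unfolding R_def D_add[OF c] using V_eq[OF z, of "D c"] by (metis diff_eq_eq)
  have Rl2: "R c \<in> l2 K" if "c \<in> l2 K" for c
    unfolding R_def using that by (rule l2_add)
  have right: "mat_app K Am (R c) = c" if c: "c \<in> l2 K" for c
    unfolding app[OF Rl2[OF c]] DR[OF c] by (simp add: R_def)
  have bij: "bij_betw (mat_app K Am) (l2 K) (l2 K)"
  proof (rule bij_betw_byWitness[where f' = R])
    show "mat_app K Am ` l2 K \<subseteq> l2 K"
    proof (rule image_subsetI)
      show "mat_app K Am c \<in> l2 K" if "c \<in> l2 K" for c
        unfolding app[OF that] using that by (rule l2_add)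
    qed
  qed (use left right Rl2 in auto)
  define E where "E = (\<lambda>k l. if l \<in> K then the_inv_into (l2 K) (mat_app K Am) (\<lambda>j. of_bool (j = l)) k else 0)"
  have E: "E \<in> \<A>" unfolding E_def using Am bij by (rule inverse_closed)
  \<comment> \<open>The columns of the inverse are read off by applying \<open>R\<close> to unit
    vectors, for which D e is \<psi>_l.\<close>
  have "E k l = idmat k l + z * op_mat (V z) k l" for k l
  proof (cases "l \<in> K")
    case True
    define e where "e = (\<lambda>j. of_bool (j = l) :: complex)"
    have "e \<in> fin_seqs K" using True by (auto simp: e_def fin_seqs_def seqs_def)
    hence e: "e \<in> l2 K" using fin_seqs_subset_lp[of 2 K "\<lambda>_. 1"] by auto
    have "((\<lambda>k. e k *\<^sub>C \<psi> k) has_sum \<psi> l) K"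
      using True by (intro has_sum_finite_neutralI[where B = "{l}"]) (auto simp: e_def)
    hence De: "D e = \<psi> l" using synthesis_has_sum[OF e] by (metis has_sum_unique)
    have "the_inv_into (l2 K) (mat_app K Am) e = R e"
      using bij e Rl2 right by (intro the_inv_into_f_eq) (auto simp: bij_betw_def)
    hence "E k l = R e k" using True by (simp add: E_def e_def)
    also have "\<dots> = idmat k l + z * op_mat (V z) k l"
      unfolding R_def De using True by (auto simp: e_def idmat_def op_mat_def analysis_op_def)
    finally show ?thesis .
  qed (auto simp: E_def idmat_def op_mat_def)
  hence "op_mat (V z) = (\<lambda>k l. inverse z * (E k l - idmat k l))"
    using z0 by (intro ext) simp
  thus ?thesis using E by (simp add: scale_closed diff_closed idmat_closed)
qed

text \<open>Submultiplicativity applied to the resolvent identity. It becomes a Lipschitz estimate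
  once the two norms on the right are bounded along the circle.\<close>

lemma norm_resolvent_diff:
  assumes z: "1 < a * cmod z" and y: "1 < a * cmod y"
  shows "N (\<lambda>k l. op_mat (V y) k l - op_mat (V z) k l) \<le> cmod (y - z) * (N (op_mat (V y)) * N (op_mat (V z)))"
proof -
  have "(\<lambda>k l. op_mat (V y) k l - op_mat (V z) k l) = op_mat (\<lambda>x. V y x - V z x)"
    by (simp add: op_mat_diff)
  also have "\<dots> = (\<lambda>k l. (y - z) * mat_mult K (op_mat (V y)) (op_mat (V z)) k l)"
    unfolding V_resolvent_identity[OF z y] op_mat_scale op_mat_mult[OF bounded_clinear_V[OF y]] ..
  finally show ?thesis
    using norm_mult[of "op_mat (V y)" "op_mat (V z)"] resolvent_closed[OF y] resolvent_closed[OF z]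
    by (simp add: norm_scale mult_closed mult_left_mono)
qed

text \<open>Compactness provides the uniform bound that inverse-closedness does not:
  \<open>norm_resolvent_diff\<close> makes the norm of the resolvent continuous on the
  circle.\<close>

lemma resolvent_bounded_on_circle:
  obtains M where "0 \<le> M" "\<And>z. cmod z = 2 / a \<Longrightarrow> N (op_mat (V z)) \<le> M"
proof -
  define f where "f = (\<lambda>z. N (op_mat (V z)))"
  have adm: "1 < a * cmod z" if "cmod z = 2 / a" for z
    using that a by simp
  have f: "0 \<le> f z" if "cmod z = 2 / a" for z
    unfolding f_def using resolvent_closed[OF adm[OF that]] by (rule norm_nonneg)
  have "continuous_on (sphere 0 (2 / a)) f"
    unfolding continuous_on_iff
  proof (intro ballI allI impI)
    fix z :: complex and e :: real
    assume z: "z \<in> sphere 0 (2 / a)" and e: "0 < e"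
    hence z': "cmod z = 2 / a" by simp
    \<comment> \<open>The first entry lets half of f y be absorbed, giving f y \<le> 2 * f z; the
      second turns the resulting bound into one below e. Adding 1 avoids a zero denominator.\<close>
    define d where "d = min (1 / (2 * (f z + 1))) (e / (2 * (f z)\<^sup>2 + 1))"
    have fz: "0 \<le> f z" using f[OF z'] .
    have d: "d > 0" using fz e by (auto simp: d_def intro!: divide_pos_pos add_nonneg_pos)
    have "dist (f y) (f z) < e" if y: "y \<in> sphere 0 (2 / a)" and yz: "dist y z < d" for y
    proof -
      have y': "cmod y = 2 / a" using y by simp
      have fy: "0 \<le> f y" using f[OF y'] .
      have Wy: "op_mat (V y) \<in> \<A>" and Wz: "op_mat (V z) \<in> \<A>"
        using resolvent_closed adm y' z' by blast+
      have diff: "N (\<lambda>k l. op_mat (V y) k l - op_mat (V z) k l) \<le> dist y z * (f y * f z)"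
        using norm_resolvent_diff[OF adm[OF z'] adm[OF y']] by (simp add: f_def dist_norm)
      have "f y \<le> dist y z * (f y * f z) + f z"
        using norm_triangle_diff[OF Wy Wz] diff by (simp add: f_def)
      moreover have "dist y z * (f y * f z) \<le> 1 / 2 * f y"
      proof -
        have "dist y z * f z \<le> 1 / (2 * (f z + 1)) * f z"
          using yz fz by (intro mult_right_mono) (auto simp: d_def)
        also have "\<dots> \<le> 1 / 2" using fz by (simp add: field_simps)
        finally have "dist y z * f z * f y \<le> 1 / 2 * f y" using fy by (rule mult_right_mono)
        thus ?thesis by (simp add: mult_ac)
      qed
      ultimately have fy2: "f y \<le> 2 * f z" by simp
      have "\<bar>f y - f z\<bar> \<le> N (\<lambda>k l. op_mat (V y) k l - op_mat (V z) k l)"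
        using norm_triangle_diff[OF Wy Wz] norm_triangle_diff[OF Wz Wy] norm_diff_commute[OF Wy Wz]
        by (simp add: f_def abs_le_iff)
      also have "\<dots> \<le> dist y z * (2 * f z * f z)"
        using diff mult_left_mono[OF mult_right_mono[OF fy2 fz], of "dist y z"] by simp
      also have "\<dots> \<le> e / (2 * (f z)\<^sup>2 + 1) * (2 * (f z)\<^sup>2)"
        using yz fz unfolding power2_eq_square mult.assoc by (intro mult_right_mono) (auto simp: d_def power2_eq_square)
      also have "\<dots> < e"
      proof -
        have "0 < 2 * (f z)\<^sup>2 + 1" by (simp add: add_nonneg_pos)
        thus ?thesis using e by (simp add: pos_divide_less_eq distrib_left)
      qed
      finally show ?thesis by (simp add: dist_real_def)
    qed
    thus "\<exists>d>0. \<forall>y\<in>sphere 0 (2 / a). dist y z < d \<longrightarrow> dist (f y) (f z) < e"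
      using d by blast
  qed
  hence "bounded (f ` sphere 0 (2 / a))"
    by (intro compact_imp_bounded compact_continuous_image compact_sphere)
  then obtain M where M: "\<forall>x\<in>f ` sphere 0 (2 / a). norm x \<le> M" unfolding bounded_iff by blast
  show ?thesis
  proof (rule that[of "max M 0"])
    show "N (op_mat (V z)) \<le> max M 0" if "cmod z = 2 / a" for z
      using M that by (force simp: f_def)
  qed simp
qed

text \<open>The Riesz projection argument: \<open>S\<^sup>-\<^sup>1\<close> is the mean of \<open>(S - u)\<^sup>-\<^sup>1\<close> over a circle around \<open>0\<close> that
  avoids the spectrum of the Gram matrix, and on this circle the resolvent depends continuously on \<open>u\<close>
  in the norm of the algebra.\<close>

theorem dual_cross_gram_closed: "cross_gram K (dual_frame K \<psi>) \<psi> \<in> \<A>"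
proof -
  define W where "W = (\<lambda>z. op_mat (V z))"
  obtain M where M0: "0 \<le> M" and M: "\<And>z. cmod z = 2 / a \<Longrightarrow> N (W z) \<le> M"
    using resolvent_bounded_on_circle unfolding W_def by blast
  have W: "W (circ t) \<in> \<A>" for t
    unfolding W_def by (intro resolvent_closed circ_admissible)
  \<comment> \<open>The matrix of the resolvent of S at u = 1 / \<open>circ t\<close>.\<close>
  define \<Phi> where "\<Phi> = (\<lambda>t k l. circ t * W (circ t) k l)"
  have circ_diff: "cmod (circ s - circ t) \<le> 2 / a * (2 * pi) * \<bar>s - t\<bar>" for s t
  proof -
    have "cmod (circ s - circ t) = 2 / a * cmod (cis (2 * pi * s) - cis (2 * pi * t))"
      unfolding circ_def right_diff_distrib[symmetric] Real_Vector_Spaces.norm_mult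
      using a by (simp add: norm_divide)
    also have "\<dots> \<le> 2 / a * \<bar>2 * pi * s - 2 * pi * t\<bar>"
      using a by (intro mult_left_mono cmod_cis_diff_le) auto
    also have "\<dots> = 2 / a * (2 * pi) * \<bar>s - t\<bar>"
      by (simp add: abs_mult flip: right_diff_distrib)
    finally show ?thesis .
  qed
  \<comment> \<open>Product rule for z \<open>W z\<close>: the two summands account for the
    variation of \<open>W\<close> and of z, and the last factor is the Lipschitz constant of
    \<open>circ\<close>.\<close>
  define L where "L = (2 / a * (M * M) + M) * (2 / a * (2 * pi))"
  have "(\<lambda>k l. - op_mat T k l) \<in> \<A>"
  proof (rule dyadic_mean_in_algebra)
    show "\<Phi> t \<in> \<A>" for t unfolding \<Phi>_def by (intro scale_closed W)
    show "N (\<lambda>k l. \<Phi> s k l - \<Phi> t k l) \<le> L * \<bar>s - t\<bar>" for s t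
    proof -
      define \<Delta> where "\<Delta> = (\<lambda>k l. W (circ s) k l - W (circ t) k l)"
      have \<Delta>: "\<Delta> \<in> \<A>" unfolding \<Delta>_def by (intro diff_closed W)
      have "N \<Delta> \<le> cmod (circ s - circ t) * (N (W (circ s)) * N (W (circ t)))"
        unfolding \<Delta>_def W_def by (intro norm_resolvent_diff circ_admissible)
      also have "\<dots> \<le> cmod (circ s - circ t) * (M * M)"
        using M0 by (intro mult_left_mono mult_mono M norm_circ norm_nonneg W) auto
      finally have N\<Delta>: "N \<Delta> \<le> cmod (circ s - circ t) * (M * M)" .
      have "(\<lambda>k l. \<Phi> s k l - \<Phi> t k l)
          = (\<lambda>k l. circ s * \<Delta> k l + (circ s - circ t) * W (circ t) k l)"
        by (simp add: \<Phi>_def \<Delta>_def algebra_simps)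
      hence "N (\<lambda>k l. \<Phi> s k l - \<Phi> t k l)
          \<le> N (\<lambda>k l. circ s * \<Delta> k l) + N (\<lambda>k l. (circ s - circ t) * W (circ t) k l)"
        using norm_triangle[OF scale_closed[OF \<Delta>] scale_closed[OF W]] by simp
      also have "\<dots> = 2 / a * N \<Delta> + cmod (circ s - circ t) * N (W (circ t))"
        using \<Delta> W by (simp add: norm_scale norm_circ)
      also have "\<dots> \<le> 2 / a * (cmod (circ s - circ t) * (M * M)) + cmod (circ s - circ t) * M"
        using a N\<Delta> M norm_circ by (intro add_mono mult_left_mono) auto
      also have "\<dots> = (2 / a * (M * M) + M) * cmod (circ s - circ t)"
        by (simp add: algebra_simps)
      also have "\<dots> \<le> (2 / a * (M * M) + M) * (2 / a * (2 * pi) * \<bar>s - t\<bar>)"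
        using a M0 by (intro mult_left_mono circ_diff) auto
      finally show ?thesis by (simp add: L_def mult.assoc)
    qed
    fix k l
    \<comment> \<open>The dyadic means are the circle means for N = 2^m, a subsequence of those
      known to converge.\<close>
    have pow: "filterlim (\<lambda>m. (2::nat) ^ m) sequentially sequentially"
      by (rule filterlim_subseq) (simp add: strict_mono_def)
    show "(\<lambda>m. \<Sum>j<2 ^ m. (1 / 2 ^ m) * \<Phi> (real j / 2 ^ m) k l) \<longlonglongrightarrow> - op_mat T k l"
    proof (cases "k \<in> K \<and> l \<in> K")
      case True
      have "(\<lambda>N. cinner (circ_mean N (\<psi> l)) (\<psi> k)) \<longlonglongrightarrow> cinner (- T (\<psi> l)) (\<psi> k)"
        by (intro bounded_linear.tendsto[OF bounded_linear_cinner_left] circ_mean_tendsto)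
      from filterlim_compose[OF this pow]
      have "(\<lambda>m. cinner (circ_mean (2 ^ m) (\<psi> l)) (\<psi> k)) \<longlonglongrightarrow> - op_mat T k l"
        using True by (simp add: op_mat_def cinner_minus_left)
      moreover have "cinner (circ_mean (2 ^ m) (\<psi> l)) (\<psi> k)
          = (\<Sum>j<2 ^ m. (1 / 2 ^ m) * \<Phi> (real j / 2 ^ m) k l)" for m
        using True by (simp add: circ_mean_def cinner_scaleC_left cinner_sum_left \<Phi>_def W_def op_mat_def
            sum_distrib_left)
      ultimately show ?thesis by simp
    qed (auto simp: \<Phi>_def W_def op_mat_def)
  qed
  from scale_closed[OF this, of "-1"] show ?thesis by (simp add: cross_gram_dual_eq)
qed

text \<open>Writing \<psi>_k = S g, the diagonal entry is the inner product of S g with g, at least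
  a |g|^2 by the lower frame bound, while the upper frame bound keeps g from being small.\<close>

lemma dual_diagonal_ge:
  assumes k: "k \<in> K"
  shows "a * \<delta>\<^sup>2 / b\<^sup>2 \<le> cmod (cross_gram K (dual_frame K \<psi>) \<psi> k k)"
proof -
  define g where "g = T (\<psi> k)"
  have "\<delta> \<le> norm (S g)" using norm_ge[OF k] by (simp add: g_def)
  also have "\<dots> \<le> b * norm g" by (rule norm_frame_op_le)
  finally have "\<delta>\<^sup>2 \<le> (b * norm g)\<^sup>2" using \<delta> by (intro power_mono) auto
  hence "a * \<delta>\<^sup>2 / b\<^sup>2 \<le> a * (norm g)\<^sup>2"
    using a b by (simp add: field_simps power_mult_distrib)
  also have "\<dots> \<le> Re (cinner (S g) g)" by (rule frame_op_lower)
  also have "\<dots> \<le> cmod (cinner (S g) g)" by (rule complex_Re_le_cmod)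
  also have "cinner (S g) g = cross_gram K (dual_frame K \<psi>) \<psi> k k"
    using k by (simp add: cross_gram_def dual_frame_eq g_def)
  finally show ?thesis .
qed

end

section \<open>Coefficients of coorbit spaces\<close>

text \<open>Dominated convergence: the M-test makes the partial sums converge uniformly in n, which
  permits exchanging the two limits.\<close>

lemma infsum_dominated_tendsto:
  fixes f :: "nat \<Rightarrow> 'k \<Rightarrow> complex"
  assumes lim: "\<And>l. l \<in> K \<Longrightarrow> (\<lambda>n. f n l) \<longlonglongrightarrow> h l"
    and le: "\<And>n l. l \<in> K \<Longrightarrow> cmod (f n l) \<le> g l"
    and g: "g summable_on K"
  shows "(\<lambda>n. \<Sum>\<^sub>\<infinity>l\<in>K. f n l) \<longlonglongrightarrow> (\<Sum>\<^sub>\<infinity>l\<in>K. h l)"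
proof (rule swap_uniform_limit')
  have "cmod (h l) \<le> g l" if "l \<in> K" for l
    using tendsto_norm[OF lim[OF that]] le[OF that] by (intro tendsto_upperbound[of _ _ sequentially]) auto
  hence "(\<lambda>l. norm (h l)) summable_on K" by (intro Infinite_Sum.abs_summable_on_comparison_test'[OF g])
  hence "h summable_on K" by (rule abs_summable_summable)
  thus "(sum h \<longlongrightarrow> (\<Sum>\<^sub>\<infinity>l\<in>K. h l)) (finite_subsets_at_top K)" by (rule infsum_tendsto)
  show "\<forall>\<^sub>F F in finite_subsets_at_top K. (\<lambda>n. \<Sum>l\<in>F. f n l) \<longlonglongrightarrow> sum h F"
    by (rule eventually_finite_subsets_at_top_weakI) (auto intro!: tendsto_sum lim)
  show "uniform_limit UNIV (\<lambda>F n. \<Sum>l\<in>F. f n l) (\<lambda>n. \<Sum>\<^sub>\<infinity>l\<in>K. f n l) (finite_subsets_at_top K)"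
    by (rule Weierstrass_m_test_general[OF _ g]) (rule le)
qed auto

lemma ennreal_pos_real_below:
  assumes "(0::ennreal) < e"
  obtains r where "0 < r" "ennreal r < e"
proof -
  obtain y where y: "0 < y" "y < e" using dense assms by blast
  then obtain r where "0 \<le> r" "y = ennreal r" by (cases y) auto
  thus ?thesis using y by (intro that[of r]) auto
qed

lemma lp_norm_tendsto_0_coord:
  fixes x :: "nat \<Rightarrow> 'k cseq"
  assumes p: "1 \<le> p" and w: "\<forall>k\<in>K. 0 < w k" and k: "k \<in> K"
    and lim: "(\<lambda>n. lp_norm K p w (x n)) \<longlonglongrightarrow> 0"
  shows "(\<lambda>n. x n k) \<longlonglongrightarrow> 0"
proof -
  have wk: "0 < w k" using w k by blast
  have "(\<lambda>n. ennreal (w k * cmod (x n k))) \<longlonglongrightarrow> 0"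
    by (rule tendsto_sandwich[OF _ _ tendsto_const lim])
       (auto intro!: always_eventually coord_le_lp_norm[OF p w k])
  hence "(\<lambda>n. w k * cmod (x n k)) \<longlonglongrightarrow> 0"
    using wk by (subst (asm) ennreal_tendsto_0_iff) auto
  hence "(\<lambda>n. (1 / w k) * (w k * cmod (x n k))) \<longlonglongrightarrow> (1 / w k) * 0"
    by (rule tendsto_mult_left)
  thus ?thesis using wk by (simp add: tendsto_norm_zero_iff)
qed

lemma lp_norm_zero:
  assumes p: "1 \<le> p" and w: "\<forall>k\<in>K. 0 < w k"
  shows "lp_norm K p w (\<lambda>_. 0) = 0"
  using lp_norm_le_iff[OF p w order_refl, of "\<lambda>_. 0"] by simp

lemma mat_app_diff:
  assumes "\<And>k. k \<in> K \<Longrightarrow> (\<lambda>l. A k l * c l) summable_on K"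
    and "\<And>k. k \<in> K \<Longrightarrow> (\<lambda>l. A k l * d l) summable_on K" and "k \<in> K"
  shows "mat_app K A (\<lambda>l. c l - d l) k = mat_app K A c k - mat_app K A d k"
proof -
  have "((\<lambda>l. A k l * c l + - (A k l * d l)) has_sum (mat_app K A c k + - mat_app K A d k)) K"
    unfolding mat_app_def using assms
    by (intro has_sum_add has_sum_uminusI has_sum_infsum)
  thus ?thesis by (simp add: mat_app_def infsumI algebra_simps)
qed

section \<open>The reproducing matrix P and the coorbit coefficients\<close>

context localized_hilbert_frame
begin

abbreviation "P \<equiv> cross_gram K (dual_frame K \<psi>) \<psi>"
abbreviation "Ct \<equiv> analysis_op K (dual_frame K \<psi>)"

lemma Ct_diff: "Ct (f - g) = (\<lambda>k. Ct f k - Ct g k)"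
  by (auto simp: analysis_op_def cinner_diff_left)

lemma mat_app_P_outside: "k \<notin> K \<Longrightarrow> mat_app K P c k = 0"
  by (simp add: mat_app_def cross_gram_def)

text \<open>The entrywise form of T S T = T; it identifies the dual coefficients as fixed points of
  P.\<close>

lemma P_reproducing:
  assumes k: "k \<in> K"
  shows "((\<lambda>l. P k l * Ct f l) has_sum Ct f k) K"
proof -
  have "((\<lambda>l. T (cinner (T f) (\<psi> l) *\<^sub>C \<psi> l)) has_sum T (S (T f))) K"
    using bounded_clinear_T by (intro has_sum_bounded_linear[OF _ frame_op_has_sum]) (simp add: bounded_clinear_def)
  from has_sum_bounded_linear[OF bounded_linear_cinner_left this, of "\<psi> k"]
  have "((\<lambda>l. cinner (T f) (\<psi> l) * cinner (T (\<psi> l)) (\<psi> k)) has_sum cinner (T f) (\<psi> k)) K"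
    by (simp add: T_scale cinner_scaleC_left)
  also have "?this \<longleftrightarrow> ((\<lambda>l. P k l * Ct f l) has_sum cinner (T f) (\<psi> k)) K"
    using k by (intro has_sum_cong) (simp add: cross_gram_dual_eq op_mat_def analysis_op_def dual_frame_eq T_symmetric)
  finally show ?thesis using k by (simp add: analysis_op_def dual_frame_eq T_symmetric)
qed

lemma Ct_synthesis:
  assumes c: "c \<in> l2 K"
  shows "Ct (D c) = mat_app K P c"
proof
  fix k
  show "Ct (D c) k = mat_app K P c k"
  proof (cases "k \<in> K")
    case True
    have "((\<lambda>l. T (c l *\<^sub>C \<psi> l)) has_sum T (D c)) K"
      using bounded_clinear_T by (intro has_sum_bounded_linear[OF _ synthesis_has_sum[OF c]]) (simp add: bounded_clinear_def)
    from has_sum_bounded_linear[OF bounded_linear_cinner_left this, of "\<psi> k"]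
    have "((\<lambda>l. c l * cinner (T (\<psi> l)) (\<psi> k)) has_sum cinner (T (D c)) (\<psi> k)) K"
      by (simp add: T_scale cinner_scaleC_left)
    also have "?this \<longleftrightarrow> ((\<lambda>l. P k l * c l) has_sum cinner (T (D c)) (\<psi> k)) K"
      using True by (intro has_sum_cong) (simp add: cross_gram_dual_eq op_mat_def)
    finally show ?thesis using True by (simp add: mat_app_def infsumI analysis_op_def dual_frame_eq T_symmetric)
  qed (simp add: mat_app_P_outside, simp add: analysis_op_def)
qed

lemma fin_seqs_l2: "fin_seqs K \<subseteq> l2 K"
  by (rule fin_seqs_subset_lp) auto

context
  fixes p :: ennreal and w :: "'k \<Rightarrow> real"
  assumes p: "1 \<le> p" and adm: "admissible K \<A> w"
begin

lemma weight_pos: "\<forall>k\<in>K. 0 < w k"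
  using adm by (auto simp: admissible_def)

lemma P_bounded: "bounded_on_lp K p w P"
  using adm p dual_cross_gram_closed by (auto simp: admissible_def)

lemma P_row_summable: "c \<in> lp K p w \<Longrightarrow> k \<in> K \<Longrightarrow> (\<lambda>l. P k l * c l) summable_on K"
  using P_bounded by (auto simp: bounded_on_lp_def)

lemma P_lp: "c \<in> lp K p w \<Longrightarrow> mat_app K P c \<in> lp K p w"
  using P_bounded by (auto simp: bounded_on_lp_def)

text \<open>Makes the definite description in \<open>coorbit_coeffs\<close> meaningful: both forms
  of equivalence force the coefficients of differences to zero, so one representative determines the
  limit of its whole class.\<close>

lemma coorbit_coeffs_class:
  assumes f: "f \<in> coorbit_seqs K \<psi> p w" and lim: "\<And>k. (\<lambda>n. Ct (f n) k) \<longlonglongrightarrow> \<alpha> k"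
  shows "coorbit_coeffs K \<psi> (coorbit_rel K \<psi> p w `` {f}) = \<alpha>"
proof -
  define X where "X = coorbit_rel K \<psi> p w `` {f}"
  have "Ct 0 = (\<lambda>_. 0)" by (auto simp: analysis_op_def)
  hence fX: "f \<in> X"
    using f lp_norm_zero[OF p weight_pos] by (simp add: X_def coorbit_rel_def coorbit_norm_def)
  have limX: "(\<lambda>n. Ct (g n) k) \<longlonglongrightarrow> \<alpha> k" if g: "g \<in> X" for g k
  proof -
    have "(\<lambda>n. Ct (f n - g n) k) \<longlonglongrightarrow> 0"
    proof (cases "k \<in> K")
      case k: True
      show ?thesis
      proof (cases "p = \<infinity>")
        case True
        thus ?thesis using g k by (auto simp: X_def coorbit_rel_def analysis_op_def)
      next
        case False
        hence "(\<lambda>n. lp_norm K p w (Ct (f n - g n))) \<longlonglongrightarrow> 0"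
          using g by (simp add: X_def coorbit_rel_def coorbit_norm_def)
        thus ?thesis by (rule lp_norm_tendsto_0_coord[OF p weight_pos k])
      qed
    qed (simp add: analysis_op_def)
    from tendsto_diff[OF lim[of k] this] show ?thesis by (simp add: Ct_diff)
  qed
  have "(THE \<alpha>. \<forall>f\<in>X. \<forall>k. (\<lambda>n. Ct (f n) k) \<longlonglongrightarrow> \<alpha> k) = \<alpha>"
  proof (rule the_equality)
    show "\<forall>f\<in>X. \<forall>k. (\<lambda>n. Ct (f n) k) \<longlonglongrightarrow> \<alpha> k" using limX by blast
    fix \<beta> assume "\<forall>f\<in>X. \<forall>k. (\<lambda>n. Ct (f n) k) \<longlonglongrightarrow> \<beta> k"
    hence "(\<lambda>n. Ct (f n) k) \<longlonglongrightarrow> \<beta> k" for k using fX by blast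
    thus "\<beta> = \<alpha>" using lim LIMSEQ_unique by blast
  qed
  thus ?thesis by (simp add: coorbit_coeffs_def X_def)
qed

text \<open>For p = \<infinity> the coefficients converge coordinatewise only, so P \<alpha> =
  \<alpha> is obtained by dominated convergence in each row of P.\<close>

lemma coorbit_seqs_limit_infinity:
  assumes f: "f \<in> coorbit_seqs K \<psi> p w" and inf: "p = \<infinity>"
  shows "\<exists>\<alpha>\<in>lp K p w. mat_app K P \<alpha> = \<alpha> \<and> (\<forall>k. (\<lambda>n. Ct (f n) k) \<longlonglongrightarrow> \<alpha> k)"
proof -
  define \<alpha> where "\<alpha> = (\<lambda>k. lim (\<lambda>n. Ct (f n) k))"
  have lim: "(\<lambda>n. Ct (f n) k) \<longlonglongrightarrow> \<alpha> k" for k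
  proof (cases "k \<in> K")
    case True
    thus ?thesis using f inf by (simp add: coorbit_seqs_def \<alpha>_def analysis_op_def convergent_LIMSEQ_iff)
  qed (simp add: analysis_op_def \<alpha>_def)
  have outside: "\<alpha> k = 0" if "k \<notin> K" for k
    using that by (simp add: \<alpha>_def analysis_op_def)
  have "(SUP n. lp_norm K p w (Ct (f n))) < \<infinity>"
    using f inf by (simp add: coorbit_seqs_def)
  then obtain r where r: "0 \<le> r" "(SUP n. lp_norm K p w (Ct (f n))) = ennreal r"
    by (cases "SUP n. lp_norm K p w (Ct (f n))") auto
  have le: "lp_norm K p w (Ct (f n)) \<le> ennreal r" for n
    unfolding r(2)[symmetric] by (rule SUP_upper) simp
  have "lp_norm K p w \<alpha> \<le> ennreal r"
    by (rule lp_norm_limit_le[OF p weight_pos r(1) lim always_eventually]) (use le in blast)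
  hence \<alpha>: "\<alpha> \<in> lp K p w"
    using outside by (auto simp: lp_def seqs_def le_less_trans)
  have "mat_app K P \<alpha> k = \<alpha> k" for k
  proof (cases "k \<in> K")
    case k: True
    \<comment> \<open>The largest sequence in the ball of radius r. It dominates all coefficient
      sequences, and since it lies in the space itself, admissibility makes the rows of P summable
      against it.\<close>
    define e where "e = (\<lambda>l. if l \<in> K then complex_of_real (r / w l) else 0)"
    have "lp_norm K p w e \<le> ennreal r"
      unfolding lp_norm_le_iff[OF p weight_pos r(1)] using r(1) weight_pos inf
      by (auto simp: lp_fam_def lp_exp_def e_def norm_divide)
    hence "e \<in> lp K p w" by (auto simp: lp_def seqs_def e_def le_less_trans)
    hence "(\<lambda>l. P k l * e l) summable_on K" using k by (rule P_row_summable)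
    hence dom: "(\<lambda>l. cmod (P k l * e l)) summable_on K"
      by (rule summable_on_iff_abs_summable_on_complex[THEN iffD1])
    have "cmod (P k l * Ct (f n) l) \<le> cmod (P k l * e l)" if l: "l \<in> K" for n l
    proof -
      have wl: "0 < w l" using weight_pos l by blast
      have "ennreal (w l * cmod (Ct (f n) l)) \<le> ennreal r"
        using coord_le_lp_norm[OF p weight_pos l] le by (rule order_trans)
      hence "w l * cmod (Ct (f n) l) \<le> r" using r(1) by simp
      hence "cmod (Ct (f n) l) \<le> cmod (e l)"
        using l wl r(1) by (simp add: e_def norm_divide field_simps)
      thus ?thesis by (simp add: Real_Vector_Spaces.norm_mult mult_left_mono)
    qed
    hence "(\<lambda>n. \<Sum>\<^sub>\<infinity>l\<in>K. P k l * Ct (f n) l) \<longlonglongrightarrow> (\<Sum>\<^sub>\<infinity>l\<in>K. P k l * \<alpha> l)"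
      by (intro infsum_dominated_tendsto[OF _ _ dom] tendsto_mult_left lim)
    hence "(\<lambda>n. Ct (f n) k) \<longlonglongrightarrow> mat_app K P \<alpha> k"
      using infsumI[OF P_reproducing[OF k]] by (simp add: mat_app_def)
    thus ?thesis using lim[of k] LIMSEQ_unique by blast
  qed (simp add: mat_app_P_outside outside)
  thus ?thesis using \<alpha> lim by (intro bexI[of _ \<alpha>]) auto
qed

text \<open>The coordinatewise limit is a norm limit by the Fatou property, with one index of the
  Cauchy condition held fixed. Boundedness of P then carries the fixed point equation over from the
  \<open>x n\<close> to \<alpha>.\<close>

lemma coorbit_seqs_limit_finite:
  assumes f: "f \<in> coorbit_seqs K \<psi> p w" and fin: "p \<noteq> \<infinity>"
  shows "\<exists>\<alpha>\<in>lp K p w. mat_app K P \<alpha> = \<alpha> \<and> (\<forall>k. (\<lambda>n. Ct (f n) k) \<longlonglongrightarrow> \<alpha> k)"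
proof -
  define x where "x = (\<lambda>n. Ct (f n))"
  have xlp: "x n \<in> lp K p w" for n
  proof -
    have "f n \<in> D ` fin_seqs K" using f fin by (simp add: coorbit_seqs_def H00_def)
    then obtain c where c: "c \<in> fin_seqs K" "f n = D c" by blast
    have "x n = mat_app K P c"
      using c fin_seqs_l2 by (auto simp: x_def Ct_synthesis)
    thus ?thesis using c fin_seqs_subset_lp[OF p weight_pos] P_lp by auto
  qed
  have cauchy: "\<exists>M. \<forall>m\<ge>M. \<forall>n\<ge>M. lp_norm K p w (\<lambda>k. x m k - x n k) < ennreal e" if "0 < e" for e
    using f fin that by (simp add: coorbit_seqs_def coorbit_norm_def Ct_diff x_def)
  define \<alpha> where "\<alpha> = (\<lambda>k. lim (\<lambda>n. x n k))"
  have lim: "(\<lambda>n. x n k) \<longlonglongrightarrow> \<alpha> k" for k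
  proof (cases "k \<in> K")
    case k: True
    have wk: "0 < w k" using weight_pos k by blast
    have "Cauchy (\<lambda>n. x n k)"
    proof (rule metric_CauchyI)
      fix e :: real assume e: "0 < e"
      obtain M where M: "\<And>m n. M \<le> m \<Longrightarrow> M \<le> n \<Longrightarrow>
          lp_norm K p w (\<lambda>k. x m k - x n k) < ennreal (w k * e)"
        using cauchy[of "w k * e"] wk e by auto
      have "dist (x m k) (x n k) < e" if "M \<le> m" "M \<le> n" for m n
      proof -
        have "ennreal (w k * cmod (x m k - x n k)) < ennreal (w k * e)"
          using coord_le_lp_norm[OF p weight_pos k, of "\<lambda>k. x m k - x n k"] M[OF that]
          by (rule le_less_trans)
        hence "w k * cmod (x m k - x n k) < w k * e"
          using wk by (subst (asm) ennreal_less_iff) auto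
        thus ?thesis using wk by (simp add: dist_norm)
      qed
      thus "\<exists>M. \<forall>m\<ge>M. \<forall>n\<ge>M. dist (x m k) (x n k) < e" by blast
    qed
    thus ?thesis by (simp add: \<alpha>_def Cauchy_convergent convergent_LIMSEQ_iff[symmetric])
  qed (simp add: x_def analysis_op_def \<alpha>_def)
  have outside: "\<alpha> k = 0" if "k \<notin> K" for k
    using that by (simp add: \<alpha>_def x_def analysis_op_def)
  have close: "\<exists>M. \<forall>n\<ge>M. lp_norm K p w (\<lambda>k. \<alpha> k - x n k) \<le> ennreal e" if e: "0 < e" for e
  proof -
    obtain M where M: "\<And>m n. M \<le> m \<Longrightarrow> M \<le> n \<Longrightarrow>
        lp_norm K p w (\<lambda>k. x m k - x n k) < ennreal e"
      using cauchy[OF e] by auto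
    have "lp_norm K p w (\<lambda>k. \<alpha> k - x n k) \<le> ennreal e" if "M \<le> n" for n
    proof (rule lp_norm_limit_le[OF p weight_pos less_imp_le[OF e]])
      show "(\<lambda>m. x m k - x n k) \<longlonglongrightarrow> \<alpha> k - x n k" for k
        by (intro tendsto_diff lim tendsto_const)
      show "\<forall>\<^sub>F m in sequentially. lp_norm K p w (\<lambda>k. x m k - x n k) \<le> ennreal e"
        using M that by (intro eventually_sequentiallyI[of M]) (auto intro: less_imp_le)
    qed
    thus ?thesis by blast
  qed
  obtain M where "lp_norm K p w (\<lambda>k. \<alpha> k - x M k) \<le> ennreal 1"
    using close[of 1] by auto
  hence "lp_norm K p w (\<lambda>k. \<alpha> k - x M k) < \<infinity>"
    by (rule le_less_trans) simp
  moreover have "(\<lambda>k. \<alpha> k - x M k) \<in> seqs K"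
    using outside by (auto simp: seqs_def x_def analysis_op_def)
  ultimately have "(\<lambda>k. \<alpha> k - x M k) \<in> lp K p w"
    by (simp add: lp_def)
  from lp_add[OF p weight_pos this xlp[of M]] have \<alpha>: "\<alpha> \<in> lp K p w" by simp
  obtain B where B: "\<And>c. c \<in> lp K p w \<Longrightarrow> lp_norm K p w (mat_app K P c) \<le> ennreal B * lp_norm K p w c"
    using P_bounded by (auto simp: bounded_on_lp_def)
  have diff: "(\<lambda>k. \<alpha> k - x n k) \<in> lp K p w" for n
    by (rule lp_diff[OF p weight_pos \<alpha> xlp])
  have null: "(\<lambda>n. lp_norm K p w (\<lambda>k. \<alpha> k - x n k)) \<longlonglongrightarrow> 0"
  proof (rule order_tendstoI)
    fix e :: ennreal assume "0 < e"
    then obtain r where r: "0 < r" "ennreal r < e"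
      by (rule ennreal_pos_real_below)
    obtain M where "\<And>n. M \<le> n \<Longrightarrow> lp_norm K p w (\<lambda>k. \<alpha> k - x n k) \<le> ennreal r"
      using close[OF r(1)] by auto
    thus "\<forall>\<^sub>F n in sequentially. lp_norm K p w (\<lambda>k. \<alpha> k - x n k) < e"
      using r(2) by (intro eventually_sequentiallyI[of M]) (auto intro: le_less_trans)
  qed simp
  have "(\<lambda>n. ennreal B * lp_norm K p w (\<lambda>k. \<alpha> k - x n k)) \<longlonglongrightarrow> ennreal B * 0"
    by (intro ennreal_tendsto_cmult null) simp
  hence upper: "(\<lambda>n. ennreal B * lp_norm K p w (\<lambda>k. \<alpha> k - x n k)) \<longlonglongrightarrow> 0" by simp
  have Pnull: "(\<lambda>n. lp_norm K p w (mat_app K P (\<lambda>k. \<alpha> k - x n k))) \<longlonglongrightarrow> 0"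
    by (rule tendsto_sandwich[OF _ _ tendsto_const upper]) (auto intro!: always_eventually B diff)
  have "mat_app K P \<alpha> k = \<alpha> k" for k
  proof (cases "k \<in> K")
    case k: True
    have "mat_app K P (\<lambda>k. \<alpha> k - x n k) k = mat_app K P \<alpha> k - x n k" for n
      using mat_app_diff[of K P \<alpha> "x n" k] P_row_summable \<alpha> xlp k infsumI[OF P_reproducing[OF k]]
      by (simp add: mat_app_def x_def)
    hence "(\<lambda>n. mat_app K P \<alpha> k - x n k) \<longlonglongrightarrow> 0"
      using lp_norm_tendsto_0_coord[OF p weight_pos k Pnull] by simp
    from tendsto_diff[OF tendsto_const[of "mat_app K P \<alpha> k"] this]
    have "(\<lambda>n. x n k) \<longlonglongrightarrow> mat_app K P \<alpha> k" by simp
    thus ?thesis using lim[of k] LIMSEQ_unique by blast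
  qed (simp add: mat_app_P_outside outside)
  thus ?thesis using \<alpha> lim unfolding x_def by (intro bexI[of _ \<alpha>]) auto
qed

text \<open>The representative is synthesised from truncations of c, whose dual coefficients are P
  applied to them. Truncations are Cauchy for p < \<infinity>; for p = \<infinity> they are merely
  bounded, which is what the definition asks for.\<close>

lemma coorbit_seqs_approx:
  assumes K: "countable K" and c: "c \<in> lp K p w"
  shows "\<exists>f\<in>coorbit_seqs K \<psi> p w. \<forall>k. (\<lambda>n. Ct (f n) k) \<longlonglongrightarrow> mat_app K P c k"
proof -
  define t where "t = (\<lambda>n. trunc (exhaust K n) c)"
  have tfin: "t n \<in> fin_seqs K" for n
    unfolding t_def by (rule trunc_exhaust_fin_seqs[OF K])
  have tl2: "t n \<in> l2 K" for n using tfin fin_seqs_l2 by blast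
  define f where "f = (\<lambda>n. D (t n))"
  have Ctf: "Ct (f n) = mat_app K P (t n)" for n
    unfolding f_def by (rule Ct_synthesis[OF tl2])
  have lim: "(\<lambda>n. Ct (f n) k) \<longlonglongrightarrow> mat_app K P c k" for k
  proof (cases "k \<in> K")
    case True
    have "Ct (f n) k = (\<Sum>l\<in>exhaust K n. P k l * c l)" for n
    proof -
      have "((\<lambda>l. P k l * t n l) has_sum (\<Sum>l\<in>exhaust K n. P k l * c l)) K"
        using exhaust_finite[OF K] exhaust_subset[of K n]
        by (intro has_sum_finite_neutralI[where B = "exhaust K n"]) (auto simp: t_def trunc_def)
      thus ?thesis by (simp add: Ctf mat_app_def infsumI)
    qed
    moreover have "(\<lambda>n. \<Sum>l\<in>exhaust K n. P k l * c l) \<longlonglongrightarrow> mat_app K P c k"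
      unfolding mat_app_def
      by (rule filterlim_compose[OF infsum_tendsto[OF P_row_summable[OF c True]] filterlim_exhaust[OF K]])
    ultimately show ?thesis by simp
  qed (simp add: mat_app_P_outside, simp add: analysis_op_def)
  obtain B where B: "\<And>c. c \<in> lp K p w \<Longrightarrow> lp_norm K p w (mat_app K P c) \<le> ennreal B * lp_norm K p w c"
    using P_bounded by (auto simp: bounded_on_lp_def)
  have tlp: "t n \<in> lp K p w" for n using tfin fin_seqs_subset_lp[OF p weight_pos] by blast
  have "f \<in> coorbit_seqs K \<psi> p w"
  proof (cases "p = \<infinity>")
    case True
    have "(SUP n. lp_norm K p w (Ct (f n))) \<le> ennreal B * lp_norm K p w c"
    proof (rule SUP_least)
      fix n
      have "lp_norm K p w (Ct (f n)) \<le> ennreal B * lp_norm K p w (t n)"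
        unfolding Ctf by (rule B[OF tlp])
      also have "\<dots> \<le> ennreal B * lp_norm K p w c"
        by (intro mult_left_mono lp_norm_mono[OF p weight_pos]) (auto simp: t_def trunc_def)
      finally show "lp_norm K p w (Ct (f n)) \<le> ennreal B * lp_norm K p w c" .
    qed
    also have "\<dots> < \<infinity>" using c by (simp add: lp_def ennreal_mult_less_top)
    finally have "(SUP n. lp_norm K p w (Ct (f n))) < \<infinity>" .
    moreover have "convergent (\<lambda>n. cinner (f n) (dual_frame K \<psi> k))" if "k \<in> K" for k
      using lim[of k] that by (auto simp: analysis_op_def convergent_def)
    ultimately show ?thesis using True by (simp add: coorbit_seqs_def)
  next
    case False
    have "\<exists>M. \<forall>m\<ge>M. \<forall>n\<ge>M. coorbit_norm K \<psi> p w (f m - f n) < e" if "0 < e" for e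
    proof -
      obtain r where r: "0 < r" "ennreal r < e"
        using \<open>0 < e\<close> by (rule ennreal_pos_real_below)
      \<comment> \<open>Ensures \<open>max B 0 * s \<le> r\<close>; the real B may be negative or
        zero.\<close>
      define s where "s = r / (max B 0 + 1)"
      have s: "0 < s" using r(1) by (simp add: s_def add_nonneg_pos)
      obtain M where M: "\<And>m n. M \<le> m \<Longrightarrow> M \<le> n \<Longrightarrow> lp_norm K p w (\<lambda>k. t m k - t n k) \<le> ennreal s"
        using lp_norm_trunc_Cauchy[OF p False weight_pos c s] unfolding t_def by blast
      have "coorbit_norm K \<psi> p w (f m - f n) < e" if mn: "M \<le> m" "M \<le> n" for m n
      proof -
        have "Ct (f m - f n) = mat_app K P (\<lambda>k. t m k - t n k)"
        proof
          fix k
          show "Ct (f m - f n) k = mat_app K P (\<lambda>k. t m k - t n k) k"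
          proof (cases "k \<in> K")
            case True
            thus ?thesis
              using mat_app_diff[of K P "t m" "t n" k] P_row_summable[OF tlp] by (simp add: Ct_diff Ctf)
          qed (simp add: mat_app_P_outside, simp add: analysis_op_def)
        qed
        hence "coorbit_norm K \<psi> p w (f m - f n) \<le> ennreal B * lp_norm K p w (\<lambda>k. t m k - t n k)"
          unfolding coorbit_norm_def using B[OF lp_diff[OF p weight_pos tlp tlp]] by simp
        also have "\<dots> \<le> ennreal (max B 0) * ennreal s"
          using M[OF mn] by (intro mult_mono) (auto intro: ennreal_leI)
        also have "\<dots> = ennreal (max B 0 * s)" using s by (simp add: ennreal_mult)
        also have "\<dots> \<le> ennreal r"
          using r(1) by (intro ennreal_leI) (simp add: s_def field_simps)
        also have "\<dots> < e" by (rule r)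
        finally show ?thesis .
      qed
      thus ?thesis by blast
    qed
    thus ?thesis using False tfin by (auto simp: coorbit_seqs_def H00_def f_def)
  qed
  thus ?thesis using lim by blast
qed

text \<open>A coefficient sequence \<alpha> lies in the image because it is fixed by P; conversely
  truncations of c approximate P c.\<close>

theorem coorbit_coeffs_range:
  assumes K: "countable K"
  shows "coorbit_coeffs K \<psi> ` coorbit K \<psi> p w = mat_app K P ` lp K p w"
proof (intro equalityI subsetI)
  fix \<beta> assume "\<beta> \<in> coorbit_coeffs K \<psi> ` coorbit K \<psi> p w"
  then obtain f where f: "f \<in> coorbit_seqs K \<psi> p w"
    "\<beta> = coorbit_coeffs K \<psi> (coorbit_rel K \<psi> p w `` {f})"
    by (auto simp: coorbit_def quotient_def)
  obtain \<alpha> where "\<alpha> \<in> lp K p w" "mat_app K P \<alpha> = \<alpha>" "\<And>k. (\<lambda>n. Ct (f n) k) \<longlonglongrightarrow> \<alpha> k"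
    using coorbit_seqs_limit_infinity[OF f(1)] coorbit_seqs_limit_finite[OF f(1)] by blast
  thus "\<beta> \<in> mat_app K P ` lp K p w"
    using coorbit_coeffs_class[OF f(1)] f(2) by (metis image_eqI)
next
  fix \<beta> assume "\<beta> \<in> mat_app K P ` lp K p w"
  then obtain f where f: "f \<in> coorbit_seqs K \<psi> p w" "\<And>k. (\<lambda>n. Ct (f n) k) \<longlonglongrightarrow> \<beta> k"
    using coorbit_seqs_approx[OF K] by blast
  from coorbit_coeffs_class[OF this] show "\<beta> \<in> coorbit_coeffs K \<psi> ` coorbit K \<psi> p w"
    using f(1) by (auto simp: coorbit_def quotient_def intro!: image_eqI)
qed

end

text \<open>Since P maps the second space into itself, the hypothesis says that P maps the first
  space into the second. Sign changes of d stay in the first space by solidity, so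
  \<open>diagonal_in_lp\<close> applies to the matrix with entries P k l * d l.\<close>

theorem lp_subset_of_range_subset:
  assumes p1: "1 \<le> p1" and w1: "admissible K \<A> w1" and p2: "1 \<le> p2" and w2: "admissible K \<A> w2"
    and sub: "mat_app K P ` lp K p1 w1 \<subseteq> mat_app K P ` lp K p2 w2"
  shows "lp K p1 w1 \<subseteq> lp K p2 w2"
proof
  fix d assume d: "d \<in> lp K p1 w1"
  note pos1 = weight_pos[OF p1 w1] and pos2 = weight_pos[OF p2 w2]
  have seqs: "d \<in> seqs K" using d by (simp add: lp_def)
  have "(\<lambda>k. if k \<in> K then P k k * d k else 0) \<in> lp K p2 w2"
  proof (rule diagonal_in_lp[OF p2 pos2, of "\<lambda>k l. P k l * d l"])
    show "(\<lambda>l. P k l * d l) summable_on K" if "k \<in> K" for k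
      using P_row_summable[OF p1 w1 d that] .
    fix \<epsilon> :: "'k \<Rightarrow> bool"
    have "(\<lambda>l. bsgn (\<epsilon> l) * d l) \<in> lp K p1 w1"
    proof (rule lp_solid[OF p1 pos1 _ d])
      show "cmod (bsgn (\<epsilon> k) * d k) \<le> cmod (d k)" for k
        by (simp add: Real_Vector_Spaces.norm_mult)
      show "(\<lambda>l. bsgn (\<epsilon> l) * d l) \<in> seqs K"
        using seqs by (simp add: seqs_def)
    qed
    hence "mat_app K P (\<lambda>l. bsgn (\<epsilon> l) * d l) \<in> mat_app K P ` lp K p2 w2"
      by (intro subsetD[OF sub] imageI)
    hence "mat_app K P (\<lambda>l. bsgn (\<epsilon> l) * d l) \<in> lp K p2 w2"
      using P_lp[OF p2 w2] by (elim imageE) simp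
    thus "(\<lambda>k. \<Sum>\<^sub>\<infinity>l\<in>K. bsgn (\<epsilon> l) * (P k l * d l)) \<in> lp K p2 w2"
      by (simp add: mat_app_def mult_ac)
  qed
  from lp_scale[OF p2 pos2 this]
  \<comment> \<open>The factor is the reciprocal of the lower bound for the diagonal of P, so the
    scaled diagonal part dominates d.\<close>
  have scaled: "(\<lambda>k. of_real (b\<^sup>2 / (a * \<delta>\<^sup>2)) * (if k \<in> K then P k k * d k else 0)) \<in> lp K p2 w2" .
  show "d \<in> lp K p2 w2"
  proof (rule lp_solid[OF p2 pos2 _ scaled seqs])
    fix k assume k: "k \<in> K"
    have ab: "0 < b\<^sup>2 / (a * \<delta>\<^sup>2)" using a b \<delta> by simp
    have "1 = b\<^sup>2 / (a * \<delta>\<^sup>2) * (a * \<delta>\<^sup>2 / b\<^sup>2)" using a b \<delta> by simp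
    also have "\<dots> \<le> b\<^sup>2 / (a * \<delta>\<^sup>2) * cmod (P k k)"
      using ab dual_diagonal_ge[OF k] by (intro mult_left_mono) auto
    finally have "1 * cmod (d k) \<le> b\<^sup>2 / (a * \<delta>\<^sup>2) * cmod (P k k) * cmod (d k)"
      by (rule mult_right_mono) simp
    also have "\<dots> = cmod (of_real (b\<^sup>2 / (a * \<delta>\<^sup>2)) * (if k \<in> K then P k k * d k else 0))"
      using k ab by (simp only: Real_Vector_Spaces.norm_mult norm_of_real abs_of_pos if_True mult.assoc)
    finally show "cmod (d k) \<le> cmod (of_real (b\<^sup>2 / (a * \<delta>\<^sup>2)) * (if k \<in> K then P k k * d k else 0))"
      by simp
  qed
qed

end

theorem theorem3:
  fixes K :: "(real ^ 'd) set"
    and \<A> :: "(real ^ 'd) cmat set" and N :: "(real ^ 'd) cmat \<Rightarrow> real"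
    and \<psi> :: "real ^ 'd \<Rightarrow> 'h::{complex_ip, complete_space}"
    and w1 w2 :: "real ^ 'd \<Rightarrow> real" and p1 p2 :: ennreal
  assumes "separable_space (euclidean :: 'h topology)"
    and "countable K" and "uniform_discrete K"
    and "solid_spectral_algebra K \<A> N"
    and "localized_frame K \<A> \<psi>"
    and "0 < (INF k\<in>K. ennreal (norm (\<psi> k)))"
    and "1 \<le> p1" and "1 \<le> p2"
    and "admissible K \<A> w1" and "admissible K \<A> w2"
  shows "coorbit_subset K \<psi> p1 w1 p2 w2 \<longleftrightarrow> lp K p1 w1 \<subseteq> lp K p2 w2"
proof -
  obtain a b where ab: "hilbert_frame K \<psi> a b"
    using assms(5) unfolding localized_frame_def is_frame_def hilbert_frame_def by blast
  \<comment> \<open>The infimum is \<infinity> when K is empty, so a real number strictly below it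
    is taken.\<close>
  obtain \<delta> where \<delta>: "0 < \<delta>" "ennreal \<delta> < (INF k\<in>K. ennreal (norm (\<psi> k)))"
    using assms(6) by (rule ennreal_pos_real_below)
  have "\<delta> \<le> norm (\<psi> k)" if "k \<in> K" for k
  proof -
    have "ennreal \<delta> \<le> ennreal (norm (\<psi> k))"
      using less_imp_le[OF \<delta>(2)] that by (simp add: le_INF_iff)
    thus ?thesis by simp
  qed
  then interpret localized_hilbert_frame K \<A> N \<psi> a b \<delta>
    using assms(4,5) ab \<delta>(1)
    by (intro localized_hilbert_frame.intro localized_hilbert_frame_axioms.intro)
       (auto simp: localized_frame_def)
  have "coorbit_subset K \<psi> p1 w1 p2 w2 \<longleftrightarrow> mat_app K P ` lp K p1 w1 \<subseteq> mat_app K P ` lp K p2 w2"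
    unfolding coorbit_subset_def
    using coorbit_coeffs_range[OF assms(7,9,2)] coorbit_coeffs_range[OF assms(8,10,2)] by simp
  also have "\<dots> \<longleftrightarrow> lp K p1 w1 \<subseteq> lp K p2 w2"
    using lp_subset_of_range_subset[OF assms(7,9,8,10)] image_mono by blast
  finally show ?thesis .
qed

end
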